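(* Let $\Omega$ be a locally compact Hausdorff space, $\alpha:\Omega\to\Omega$ an aperiodic homeomorphism, and $w:\Omega\to(0,\infty)$ a bounded positive function with $w^{-1}=1/w\in C_b(\Omega)$. Suppose that for any compact subset $K$ of $\Omega$ and any measure $\mu\in M(\Omega)$ with $|\mu|(K^{c})=0$ there exist a sequence $\{A_k\}_k$ of Borel subsets of $K$ and a strictly increasing sequence $\{n_k\}_k\subseteq\mathbb{N}$ such that $\lim_{k\to\infty}|\mu|(A_k)=0$ and $$\lim_{k\to\infty}\ \sum_{l=1}^{\infty}\ \sup_{t\in K\cap A_k^{c}}\Big(\prod_{j=0}^{ln_k-1}(w\circ\alpha^{j})(t)\Big)=\lim_{k\to\infty}\ \sum_{l=1}^{\infty}\ \sup_{t\in K\cap A_k^{c}}\Big(\prod_{j=1}^{ln_k}(w\circ\alpha^{-j})^{-1}(t)\Big)=0,$$ where the corresponding series are convergent for each $k$. Then the sequences $(T_{\alpha,w}^{*n})_n$ and $(C_{\alpha,w}^{(n)^{*}})_n$ are chaotic on $M(\Omega)$.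
   Context: $\mathbb{N}=\{1,2,\dots\}$. For $n\in\mathbb{N}$, $\alpha^n$ is the $n$-fold composition of $\alpha$ with itself, $\alpha^0=\mathrm{id}$, $\alpha^{-n}=(\alpha^{-1})^n$. A homeomorphism $\alpha$ of $\Omega$ is aperiodic if for each compact $K\subseteq\Omega$ there is $N>0$ such that $K\cap\alpha^n(K)=\varnothing$ for all $n\ge N$. $C_0(\Omega)$ is the space of continuous complex functions on $\Omega$ vanishing at infinity and $C_b(\Omega)$ that of bounded continuous functions, both with the supremum norm. $(w\circ\alpha^{-j})^{-1}$ denotes the pointwise reciprocal $1/(w\circ\alpha^{-j})$. The weighted composition operator $T_{\alpha,w}$ on $C_0(\Omega)$ is $T_{\alpha,w}f=w\cdot(f\circ\alpha)$; it is bounded and invertible, with inverse $S_{\alpha,w}f=(f\circ\alpha^{-1})/(w\circ\alpha^{-1})$. $M(\Omega)$ is the Banach space of complex Radon measures on $\Omega$ with the total variation norm $\|\mu\|=|\mu|(\Omega)$, identified with the dual of $C_0(\Omega)$ via $\mu\mapsto(f\mapsto\int f\,d\mu)$; $T_{\alpha,w}^*$ and $S_{\alpha,w}^*$ are the adjoints of $T_{\alpha,w}$ and $S_{\alpha,w}$, acting on $M(\Omega)$; thus $T_{\alpha,w}^*(\mu)(E)=\int_E w\circ\alpha^{-1}\,d(\mu\circ\alpha^{-1})$ for Borel $E$, where $(\mu\circ\alpha^{-1})(E)=\mu(\alpha^{-1}(E))$, and $S_{\alpha,w}^*=(T_{\alpha,w}^* )^{-1}$. For $n\in\mathbb{N}$,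 $C_{\alpha,w}^{(n)^{*}}=\frac12\big(T_{\alpha,w}^{*n}+S_{\alpha,w}^{*n}\big)$. A sequence $(T_n)_n$ of bounded operators on a Banach space $\mathcal X$ is topologically transitive if for all non-empty open $U,V\subseteq\mathcal X$ there is $n\in\mathbb{N}$ with $T_n(U)\cap V\ne\varnothing$. A vector $x\in\mathcal X$ is a periodic element of $(T_n)_n$ if there is $N\in\mathbb{N}$ with $T_{kN}x=x$ for every $k\in\mathbb{N}$. The sequence $(T_n)_n$ is chaotic if it is topologically transitive and its set of periodic elements is dense in $\mathcal X$. Complements are taken in $\Omega$. The supremum of a nonnegative quantity over the empty set is taken to be $0$. *)

theory Defs
  imports "HOL-Analysis.Analysis"
begin

text \<open>A (real or complex) measure is a countably additive function on the Borel sets; functions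
  are normalised to be \<open>0\<close> on non-Borel sets, so that distinct functions are distinct measures.
  Countable additivity forces the value \<open>0\<close> on the empty set and, for complex measures, finite
  total variation (both proved below).\<close>

definition vector_measure :: "('a::topological_space set \<Rightarrow> 'b::real_normed_vector) \<Rightarrow> bool" where
  "vector_measure m \<longleftrightarrow>
    (\<forall>A::nat \<Rightarrow> 'a set. range A \<subseteq> sets borel \<longrightarrow> disjoint_family A \<longrightarrow>
      (\<lambda>n. m (A n)) sums m (\<Union>n. A n)) \<and>
    (\<forall>E. E \<notin> sets borel \<longrightarrow> m E = 0)"

definition borel_partitions :: "'a::topological_space set \<Rightarrow> 'a set set set" where
  "borel_partitions E = {P. finite P \<and> P \<subseteq> sets borel \<and> disjoint P \<and> \<Union>P = E}"

text \<open>\<open>variation m\<close> is the total variation \<open>|m|\<close> (with value \<open>0\<close> on non-Borel sets, which have no Borel partition).\<close>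

definition variation ::
  "('a::topological_space set \<Rightarrow> 'b::real_normed_vector) \<Rightarrow> 'a set \<Rightarrow> ennreal" where
  "variation m E = (SUP P\<in>borel_partitions E. \<Sum>B\<in>P. ennreal (norm (m B)))"

definition variation_measure ::
  "('a::topological_space set \<Rightarrow> 'b::real_normed_vector) \<Rightarrow> 'a measure" where
  "variation_measure m = measure_of UNIV (sets borel) (variation m)"

text \<open>A complex measure is Radon if its total variation is inner regular with respect to compact
  sets and outer regular with respect to open sets, on all Borel sets.\<close>

definition radon :: "('a::t2_space set \<Rightarrow> complex) \<Rightarrow> bool" where
  "radon m \<longleftrightarrow> vector_measure m \<and>
    (\<forall>E\<in>sets borel.
      variation m E = (SUP K\<in>{K. compact K \<and> K \<subseteq> E}. variation m K) \<and>
      variation m E = (INF U\<in>{U. open U \<and> E \<subseteq> U}. variation m U))"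

lemma vector_measureD:
  assumes "vector_measure m" "range A \<subseteq> sets borel" "disjoint_family (A::nat \<Rightarrow> _)"
  shows "(\<lambda>n. m (A n)) sums m (\<Union>n. A n)"
  using assms unfolding vector_measure_def by blast

lemma vector_measure_nonborel: "vector_measure m \<Longrightarrow> E \<notin> sets borel \<Longrightarrow> m E = 0"
  by (simp add: vector_measure_def)

lemma vector_measure_empty:
  assumes "vector_measure m" shows "m {} = 0"
proof -
  have "(\<lambda>n::nat. m {}) sums m {}"
    using vector_measureD[OF assms, of "\<lambda>_. {}"] by (simp add: disjoint_family_on_def)
  then have "(\<lambda>n::nat. m {}) \<longlonglongrightarrow> 0"
    using sums_summable summable_LIMSEQ_zero by blast
  then show ?thesis
    using LIMSEQ_unique tendsto_const by blast
qed

lemma vector_measure_Un: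
  assumes m: "vector_measure m" and "A \<in> sets borel" "B \<in> sets borel" "A \<inter> B = {}"
  shows "m (A \<union> B) = m A + m B"
proof -
  have "(\<lambda>n. m (binaryset A B n)) sums m (\<Union>n. binaryset A B n)"
    using assms by (intro vector_measureD) (auto simp: range_binaryset_eq disjoint_family_on_def binaryset_def)
  moreover have "(\<lambda>n. m (binaryset A B n)) sums (m A + m B)"
    by (rule binaryset_sums) (rule vector_measure_empty[OF m])
  ultimately show ?thesis
    by (simp add: UN_binaryset_eq sums_unique2)
qed

lemma vector_measure_Union:
  assumes m: "vector_measure m" and "finite P" "P \<subseteq> sets borel" "disjoint P"
  shows "m (\<Union>P) = sum m P"
  using assms(2-)
proof (induction P)
  case empty
  then show ?case by (simp add: vector_measure_empty[OF m])
next
  case (insert B P)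
  have "B \<inter> C = {}" if "C \<in> P" for C
    using disjointD[OF insert.prems(2), of B C] insert.hyps(2) that by auto
  then have "B \<inter> \<Union>P = {}" by blast
  moreover have "disjoint P"
    using insert.prems(2) by (rule pairwise_subset) auto
  moreover have "\<Union>P \<in> sets borel"
    using insert.prems(1) insert.hyps(1) by (metis insert_subset sets.finite_Union)
  ultimately show ?case
    using insert vector_measure_Un[OF m, of B "\<Union>P"] by simp
qed

lemma vector_measure_Diff:
  assumes m: "vector_measure m" and "A \<in> sets borel" "B \<in> sets borel" "B \<subseteq> A"
  shows "m (A - B) = m A - m B"
proof -
  have "m (B \<union> (A - B)) = m B + m (A - B)"
    using assms by (intro vector_measure_Un) auto
  moreover have "B \<union> (A - B) = A" using assms(4) by blast
  ultimately show ?thesis by simp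
qed

lemma singleton_borel_partition:
  "E \<in> sets borel \<Longrightarrow> {E} \<in> borel_partitions E"
  by (auto simp: borel_partitions_def)

lemma norm_le_variation: "E \<in> sets borel \<Longrightarrow> ennreal (norm (m E)) \<le> variation m E"
  unfolding variation_def
  using singleton_borel_partition[of E] by (auto intro: SUP_upper2)

lemma variation_nonborel:
  assumes "E \<notin> sets borel" shows "variation m E = 0"
proof -
  have "borel_partitions E = {}"
    using assms by (auto simp: borel_partitions_def)
  then show ?thesis by (simp add: variation_def bot_ennreal)
qed

lemma variation_empty:
  assumes m: "vector_measure m" shows "variation m {} = 0"
proof -
  have "(\<Sum>B\<in>P. ennreal (norm (m B))) = 0" if "P \<in> borel_partitions {}" for P
    using that by (intro sum.neutral) (auto simp: borel_partitions_def vector_measure_empty[OF m])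
  then show ?thesis
    unfolding variation_def by (auto intro!: antisym SUP_least)
qed

lemma variation_superadditive:
  assumes m: "vector_measure m" and E: "E \<in> sets borel" and F: "F \<in> sets borel" and EF: "E \<inter> F = {}"
  shows "variation m E + variation m F \<le> variation m (E \<union> F)"
proof -
  have *: "(\<Sum>B\<in>P. ennreal (norm (m B))) + (\<Sum>B\<in>Q. ennreal (norm (m B))) \<le> variation m (E \<union> F)"
    if P: "P \<in> borel_partitions E" and Q: "Q \<in> borel_partitions F" for P Q
  proof -
    have disj: "B \<inter> C = {}" if "B \<in> P" "C \<in> Q" for B C
      using P Q EF that by (auto simp: borel_partitions_def)
    have PQ: "P \<union> Q \<in> borel_partitions (E \<union> F)"
    proof -
      have "disjoint (P \<union> Q)"
        using P Q disj by (intro disjoint_union) (auto simp: borel_partitions_def)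
      then show ?thesis using P Q by (auto simp: borel_partitions_def)
    qed
    have "(\<Sum>B\<in>P. ennreal (norm (m B))) + (\<Sum>B\<in>Q. ennreal (norm (m B))) =
        (\<Sum>B\<in>P \<union> Q. ennreal (norm (m B))) + (\<Sum>B\<in>P \<inter> Q. ennreal (norm (m B)))"
      using P Q by (intro sum.union_inter[symmetric]) (auto simp: borel_partitions_def)
    also have "(\<Sum>B\<in>P \<inter> Q. ennreal (norm (m B))) = 0"
    proof (rule sum.neutral, safe)
      fix B assume "B \<in> P" "B \<in> Q"
      then have "B = {}" using disj by blast
      then show "ennreal (norm (m B)) = 0" by (simp add: vector_measure_empty[OF m])
    qed
    finally show ?thesis
      unfolding variation_def using PQ by (auto intro: SUP_upper2)
  qed
  have ne: "borel_partitions E \<noteq> {}" "borel_partitions F \<noteq> {}"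
    using singleton_borel_partition E F by blast+
  have "variation m E + c \<le> variation m (E \<union> F)"
    if "\<And>P. P \<in> borel_partitions E \<Longrightarrow> (\<Sum>B\<in>P. ennreal (norm (m B))) + c \<le> variation m (E \<union> F)" for c
    unfolding variation_def[of m E]
    by (subst ennreal_SUP_add_left[symmetric]) (use ne that in \<open>auto intro!: SUP_least\<close>)
  moreover have "(\<Sum>B\<in>P. ennreal (norm (m B))) + variation m F \<le> variation m (E \<union> F)"
    if "P \<in> borel_partitions E" for P
    unfolding variation_def[of m F]
    by (subst add.commute, subst ennreal_SUP_add_left[symmetric])
      (use ne in simp, rule SUP_least, subst add.commute, rule *[OF that])
  ultimately show ?thesis by blast
qed

lemma variation_mono:
  assumes m: "vector_measure m" and "E \<in> sets borel" "F \<in> sets borel" "E \<subseteq> F"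
  shows "variation m E \<le> variation m F"
proof -
  have "variation m E \<le> variation m E + variation m (F - E)" by simp
  also have "\<dots> \<le> variation m (E \<union> (F - E))"
    using assms by (intro variation_superadditive[OF m]) auto
  also have "E \<union> (F - E) = F" using assms by auto
  finally show ?thesis .
qed

lemma variation_suminf_le:
  assumes m: "vector_measure m" and A: "range A \<subseteq> sets borel" "disjoint_family (A::nat \<Rightarrow> _)"
  shows "(\<Sum>n. variation m (A n)) \<le> variation m (\<Union>n. A n)"
proof -
  have *: "(\<Sum>n<N. variation m (A n)) \<le> variation m (\<Union>n<N. A n)" for N
  proof (induction N)
    case 0 then show ?case by simp
  next
    case (Suc N)
    have "(\<Sum>n<Suc N. variation m (A n)) \<le> variation m (\<Union>n<N. A n) + variation m (A N)"
      using Suc by (simp add: add_right_mono)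
    also have "\<dots> \<le> variation m ((\<Union>n<N. A n) \<union> A N)"
    proof (intro variation_superadditive[OF m])
      show "(\<Union>n<N. A n) \<inter> A N = {}"
        using disjoint_family_onD[OF A(2), of _ N] by (auto 0 0) (metis IntI UNIV_I emptyE nat_neq_iff)
    qed (use A(1) in auto)
    also have "(\<Union>n<N. A n) \<union> A N = (\<Union>n<Suc N. A n)"
      by (auto simp: less_Suc_eq)
    finally show ?case .
  qed
  show ?thesis
  proof (rule suminf_le_const)
    fix N
    have "variation m (\<Union>n<N. A n) \<le> variation m (\<Union>n. A n)"
      using A by (intro variation_mono[OF m]) auto
    then show "(\<Sum>n<N. variation m (A n)) \<le> variation m (\<Union>n. A n)"
      using * order_trans by blast
  qed auto
qed

lemma variation_le_suminf:
  assumes m: "vector_measure m" and A: "range A \<subseteq> sets borel" "disjoint_family (A::nat \<Rightarrow> _)"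
  shows "variation m (\<Union>n. A n) \<le> (\<Sum>n. variation m (A n))"
  unfolding variation_def[of m "\<Union>n. A n"]
proof (rule SUP_least)
  fix P assume P: "P \<in> borel_partitions (\<Union>n. A n)"
  have "(\<Sum>B\<in>P. ennreal (norm (m B))) \<le> (\<Sum>B\<in>P. \<Sum>n. ennreal (norm (m (B \<inter> A n))))"
  proof (rule sum_mono)
    fix B assume B: "B \<in> P"
    have "(\<lambda>n. m (B \<inter> A n)) sums m (\<Union>n. B \<inter> A n)"
      using A P B by (intro vector_measureD[OF m]) (auto simp: disjoint_family_on_def borel_partitions_def)
    moreover have "(\<Union>n. B \<inter> A n) = B" using P B by (auto simp: borel_partitions_def)
    ultimately have s: "(\<lambda>n. m (B \<inter> A n)) sums m B" by simp
    show "ennreal (norm (m B)) \<le> (\<Sum>n. ennreal (norm (m (B \<inter> A n))))"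
    proof (rule LIMSEQ_le_const2)
      show "(\<lambda>N. ennreal (norm (\<Sum>n<N. m (B \<inter> A n)))) \<longlonglongrightarrow> ennreal (norm (m B))"
        using s unfolding sums_def by (intro tendsto_ennrealI tendsto_norm)
      have "ennreal (norm (\<Sum>n<N. m (B \<inter> A n))) \<le> (\<Sum>n. ennreal (norm (m (B \<inter> A n))))" for N
      proof -
        have "ennreal (norm (\<Sum>n<N. m (B \<inter> A n))) \<le> ennreal (\<Sum>n<N. norm (m (B \<inter> A n)))"
          by (intro ennreal_leI norm_sum)
        also have "\<dots> = (\<Sum>n<N. ennreal (norm (m (B \<inter> A n))))" by simp
        also have "\<dots> \<le> (\<Sum>n. ennreal (norm (m (B \<inter> A n))))"
          by (intro sum_le_suminf) auto
        finally show ?thesis .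
      qed
      then show "\<exists>N. \<forall>n\<ge>N. ennreal (norm (\<Sum>n<n. m (B \<inter> A n))) \<le> (\<Sum>n. ennreal (norm (m (B \<inter> A n))))"
        by blast
    qed
  qed
  also have "\<dots> = (\<Sum>n. \<Sum>B\<in>P. ennreal (norm (m (B \<inter> A n))))"
    by (rule suminf_sum[symmetric]) auto
  also have "\<dots> \<le> (\<Sum>n. variation m (A n))"
  proof (rule suminf_le)
    fix n
    have "(\<Sum>B\<in>P. ennreal (norm (m (B \<inter> A n)))) = (\<Sum>B\<in>(\<lambda>B. B \<inter> A n) ` P. ennreal (norm (m B)))"
    proof (subst sum.reindex_nontrivial)
      show "finite P" using P by (simp add: borel_partitions_def)
      fix B C assume "B \<in> P" "C \<in> P" "B \<noteq> C" "B \<inter> A n = C \<inter> A n"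
      moreover have "B \<inter> C = {}" using P \<open>B \<in> P\<close> \<open>C \<in> P\<close> \<open>B \<noteq> C\<close>
        by (auto simp: borel_partitions_def disjoint_def)
      ultimately have "B \<inter> A n = {}" by blast
      then show "ennreal (norm (m (B \<inter> A n))) = 0" by (simp add: vector_measure_empty[OF m])
    qed simp
    also have "(\<lambda>B. B \<inter> A n) ` P \<in> borel_partitions (A n)"
    proof -
      have "disjoint ((\<lambda>B. B \<inter> A n) ` P)"
        using P unfolding borel_partitions_def disjoint_def by blast
      moreover have "\<Union>((\<lambda>B. B \<inter> A n) ` P) = A n"
        using P by (auto simp: borel_partitions_def)
      ultimately show ?thesis
        using P A(1) by (auto simp: borel_partitions_def)
    qed
    then have "(\<Sum>B\<in>(\<lambda>B. B \<inter> A n) ` P. ennreal (norm (m B))) \<le> variation m (A n)"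
      unfolding variation_def by (rule SUP_upper)
    finally show "(\<Sum>B\<in>P. ennreal (norm (m (B \<inter> A n)))) \<le> variation m (A n)" .
  qed auto
  finally show "(\<Sum>B\<in>P. ennreal (norm (m B))) \<le> (\<Sum>n. variation m (A n))" .
qed

lemma sets_variation_measure [simp]: "sets (variation_measure m) = sets borel"
  by (metis sets.sets_measure_of_eq space_borel variation_measure_def)

lemma space_variation_measure [simp]: "space (variation_measure m) = UNIV"
  by (simp add: variation_measure_def)

lemma emeasure_variation_measure:
  assumes m: "vector_measure m"
  shows "emeasure (variation_measure m) E = variation m E"
proof (cases "E \<in> sets borel")
  case True
  show ?thesis
  proof (rule emeasure_measure_of[OF variation_measure_def])
    show "positive (sets (variation_measure m)) (variation m)"
      by (simp add: positive_def variation_empty[OF m])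
    show "countably_additive (sets (variation_measure m)) (variation m)"
      unfolding countably_additive_def
      by (auto intro!: antisym variation_suminf_le[OF m] variation_le_suminf[OF m])
  qed (use True in auto)
next
  case False
  then show ?thesis by (simp add: emeasure_notin_sets variation_nonborel)
qed

lemma norm_sum_subset:
  fixes z :: "'i \<Rightarrow> complex"
  assumes "finite P"
  shows "\<exists>S\<subseteq>P. (\<Sum>i\<in>P. norm (z i)) \<le> 4 * norm (sum z S)"
proof (rule ccontr)
  assume "\<not> ?thesis"
  then have *: "4 * norm (sum z S) < (\<Sum>i\<in>P. norm (z i))" if "S \<subseteq> P" for S
    using that by (meson not_le)
  have split: "(\<Sum>i\<in>P. \<bar>r i\<bar>) = (\<Sum>i\<in>{i\<in>P. r i \<ge> 0}. r i) - (\<Sum>i\<in>{i\<in>P. r i < 0}. r i)"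
    for r :: "'i \<Rightarrow> real"
  proof -
    have "(\<Sum>i\<in>P. \<bar>r i\<bar>) = (\<Sum>i\<in>{i\<in>P. r i \<ge> 0} \<union> {i\<in>P. r i < 0}. \<bar>r i\<bar>)"
      by (rule sum.cong) auto
    also have "\<dots> = (\<Sum>i\<in>{i\<in>P. r i \<ge> 0}. \<bar>r i\<bar>) + (\<Sum>i\<in>{i\<in>P. r i < 0}. \<bar>r i\<bar>)"
      using assms by (intro sum.union_disjoint) auto
    also have "(\<Sum>i\<in>{i\<in>P. r i \<ge> 0}. \<bar>r i\<bar>) = (\<Sum>i\<in>{i\<in>P. r i \<ge> 0}. r i)"
      by (intro sum.cong) auto
    also have "(\<Sum>i\<in>{i\<in>P. r i < 0}. \<bar>r i\<bar>) = (\<Sum>i\<in>{i\<in>P. r i < 0}. - r i)"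
      by (intro sum.cong) auto
    finally show ?thesis by (simp add: sum_negf)
  qed
  have re: "4 * \<bar>\<Sum>i\<in>S. Re (z i)\<bar> < (\<Sum>i\<in>P. norm (z i))" if "S \<subseteq> P" for S
    using *[OF that] abs_Re_le_cmod[of "sum z S"] by simp
  have im: "4 * \<bar>\<Sum>i\<in>S. Im (z i)\<bar> < (\<Sum>i\<in>P. norm (z i))" if "S \<subseteq> P" for S
    using *[OF that] abs_Im_le_cmod[of "sum z S"] by simp
  have "(\<Sum>i\<in>P. norm (z i)) \<le> (\<Sum>i\<in>P. \<bar>Re (z i)\<bar>) + (\<Sum>i\<in>P. \<bar>Im (z i)\<bar>)"
    unfolding sum.distrib[symmetric] by (intro sum_mono cmod_le)
  also have "\<dots> < (\<Sum>i\<in>P. norm (z i))"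
    unfolding split
    using re[of "{i\<in>P. Re (z i) \<ge> 0}"] re[of "{i\<in>P. Re (z i) < 0}"]
      im[of "{i\<in>P. Im (z i) \<ge> 0}"] im[of "{i\<in>P. Im (z i) < 0}"] by auto
  finally show False by simp
qed

lemma variation_top_split:
  fixes m :: "'a::topological_space set \<Rightarrow> complex"
  assumes m: "vector_measure m" and E: "E \<in> sets borel" and top: "variation m E = \<infinity>"
  shows "\<exists>F\<in>sets borel. F \<subseteq> E \<and> variation m F = \<infinity> \<and> norm (m (E - F)) > 1"
proof -
  have "ennreal (4 * (2 + norm (m E))) < variation m E" by (simp add: top)
  then obtain P where P: "P \<in> borel_partitions E"
    and big: "ennreal (4 * (2 + norm (m E))) < (\<Sum>B\<in>P. ennreal (norm (m B)))"
    unfolding variation_def less_SUP_iff by blast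
  have "4 * (2 + norm (m E)) < (\<Sum>B\<in>P. norm (m B))"
    using big by (subst (asm) sum_ennreal) (auto intro!: ennreal_less_iff[THEN iffD1, rotated] simp del: ennreal_plus)
  moreover obtain S where S: "S \<subseteq> P" "(\<Sum>B\<in>P. norm (m B)) \<le> 4 * norm (sum m S)"
    using norm_sum_subset[of P m] P by (auto simp: borel_partitions_def)
  moreover have S': "finite S" "S \<subseteq> sets borel" "disjoint S" "\<Union>S \<subseteq> E"
    using S P by (auto simp: borel_partitions_def finite_subset intro: pairwise_subset)
  ultimately have mA: "norm (m (\<Union>S)) > 2 + norm (m E)"
    by (simp add: vector_measure_Union[OF m])
  define A where "A = \<Union>S"
  have A: "A \<in> sets borel" "A \<subseteq> E"
    using S' by (auto simp: A_def sets.finite_Union)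
  have nA: "norm (m A) > 1" using mA unfolding A_def using norm_ge_zero[of "m E"] by linarith
  have nB: "norm (m (E - A)) > 1"
    using mA norm_triangle_ineq2[of "m A" "m E"]
    unfolding vector_measure_Diff[OF m E A] A_def[symmetric] by (simp add: norm_minus_commute)
  have "variation m E = variation m A + variation m (E - A)"
    using plus_emeasure[of A "variation_measure m" "E - A"] A E
    by (simp add: emeasure_variation_measure[OF m] Un_absorb1)
  then consider "variation m A = \<infinity>" | "variation m (E - A) = \<infinity>"
    using top by (metis ennreal_add_eq_top infinity_ennreal_def)
  then show ?thesis
  proof cases
    case 1 then show ?thesis using A nB by blast
  next
    case 2
    moreover have "E - (E - A) = A" using A by auto
    ultimately show ?thesis using A E nA by (intro bexI[of _ "E - A"]) auto
  qed
qed

lemma variation_finite: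
  fixes m :: "'a::topological_space set \<Rightarrow> complex"
  assumes m: "vector_measure m"
  shows "variation m E < \<infinity>"
proof (rule ccontr)
  assume "\<not> variation m E < \<infinity>"
  then have inf: "variation m E = \<infinity>" by (simp add: less_top[symmetric])
  moreover have "E \<in> sets borel"
    by (rule ccontr) (use inf variation_nonborel[of E m] in simp)
  ultimately have "E \<in> sets borel \<and> variation m E = \<infinity>" by simp
  then obtain F :: "nat \<Rightarrow> 'a set"
    where F: "\<And>n. F n \<in> sets borel \<and> variation m (F n) = \<infinity>"
      and F': "\<And>n. F (Suc n) \<subseteq> F n \<and> norm (m (F n - F (Suc n))) > 1"
    using dependent_nat_choice[of "\<lambda>_ F. F \<in> sets borel \<and> variation m F = \<infinity>"
        "\<lambda>_ F G. G \<subseteq> F \<and> norm (m (F - G)) > 1"] variation_top_split[OF m]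
    by blast
  have anti: "F n \<subseteq> F k" if "k \<le> n" for k n
    using that F' by (meson lift_Suc_antimono_le)
  have "disjoint_family (\<lambda>n. F n - F (Suc n))"
    unfolding disjoint_family_on_def
  proof (intro ballI impI)
    fix i j :: nat assume "i \<noteq> j"
    then have "Suc i \<le> j \<or> Suc j \<le> i" by linarith
    then show "(F i - F (Suc i)) \<inter> (F j - F (Suc j)) = {}"
      using anti by blast
  qed
  then have "(\<lambda>n. m (F n - F (Suc n))) sums m (\<Union>n. F n - F (Suc n))"
    using F by (intro vector_measureD[OF m]) auto
  then have "(\<lambda>n. norm (m (F n - F (Suc n)))) \<longlonglongrightarrow> 0"
    using sums_summable summable_LIMSEQ_zero tendsto_norm_zero by blast
  then have "eventually (\<lambda>n. norm (m (F n - F (Suc n))) < 1) sequentially"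
    by (rule order_tendstoD) simp
  then obtain n where "norm (m (F n - F (Suc n))) < 1"
    by (auto simp: eventually_sequentially)
  with F'[of n] show False by simp
qed

lemma finite_measure_variation:
  fixes m :: "'a::topological_space set \<Rightarrow> complex"
  assumes m: "vector_measure m"
  shows "finite_measure (variation_measure m)"
  using variation_finite[OF m, of UNIV] by (intro finite_measureI) (simp add: emeasure_variation_measure[OF m])

lemma vector_measure_zero: "vector_measure (\<lambda>_. 0)"
  by (simp add: vector_measure_def)

lemma vector_measure_add:
  "vector_measure m \<Longrightarrow> vector_measure n \<Longrightarrow> vector_measure (\<lambda>E. m E + n E)"
  by (auto simp: vector_measure_def intro!: sums_add)

lemma vector_measure_scaleR:
  "vector_measure m \<Longrightarrow> vector_measure (\<lambda>E. c *\<^sub>R m E)"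
  by (auto simp: vector_measure_def intro!: sums_scaleR_right)

lemma variation_add_le: "variation (\<lambda>E. m E + n E) E \<le> variation m E + variation n E"
  unfolding variation_def[of "\<lambda>E. m E + n E"]
proof (rule SUP_least)
  fix P assume P: "P \<in> borel_partitions E"
  have "(\<Sum>B\<in>P. ennreal (norm (m B + n B))) \<le> (\<Sum>B\<in>P. ennreal (norm (m B)) + ennreal (norm (n B)))"
    by (intro sum_mono) (metis ennreal_leI ennreal_plus norm_ge_zero norm_triangle_ineq)
  also have "\<dots> = (\<Sum>B\<in>P. ennreal (norm (m B))) + (\<Sum>B\<in>P. ennreal (norm (n B)))"
    by (rule sum.distrib)
  also have "\<dots> \<le> variation m E + variation n E"
    unfolding variation_def using P by (intro add_mono SUP_upper)
  finally show "(\<Sum>B\<in>P. ennreal (norm (m B + n B))) \<le> variation m E + variation n E" .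
qed

lemma variation_scaleR: "variation (\<lambda>E. c *\<^sub>R m E) E = ennreal \<bar>c\<bar> * variation m E"
  unfolding variation_def by (simp add: ennreal_mult sum_distrib_left[symmetric] SUP_mult_left_ennreal)

lemma radon_iff:
  fixes m :: "'a::t2_space set \<Rightarrow> complex"
  assumes m: "vector_measure m"
  shows "radon m \<longleftrightarrow> (\<forall>E\<in>sets borel. \<forall>e>0. \<exists>K U. compact K \<and> open U \<and> K \<subseteq> E \<and> E \<subseteq> U \<and>
    variation m (U - K) < ennreal e)"
proof -
  note em = emeasure_variation_measure[OF m, symmetric]
  interpret finite_measure "variation_measure m" by (rule finite_measure_variation[OF m])
  have cb: "K \<in> sets borel" if "compact K" for K :: "'a set"
    using that by (simp add: compact_imp_closed)
  let ?v = "measure (variation_measure m)"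
  have v: "variation m E = ennreal (?v E)" for E
    by (simp add: em emeasure_eq_measure)
  show ?thesis
  proof (intro iffI ballI allI impI)
    fix E :: "'a set" and e :: real
    assume R: "radon m" and E: "E \<in> sets borel" and e: "0 < e"
    have 1: "variation m E = (SUP K\<in>{K. compact K \<and> K \<subseteq> E}. variation m K)"
     and 2: "variation m E = (INF U\<in>{U. open U \<and> E \<subseteq> U}. variation m U)"
      using R E unfolding radon_def by blast+
    have "\<exists>K. compact K \<and> K \<subseteq> E \<and> ?v E - ?v K < e/2"
    proof (rule ccontr)
      assume "\<not> ?thesis"
      then have nl: "\<not> ?v E - ?v K < e/2" if "compact K" "K \<subseteq> E" for K
        using that by blast
      have le: "?v K \<le> ?v E - e/2" if "compact K" "K \<subseteq> E" for K
        using nl[OF that] by linarith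
      have "variation m E \<le> ennreal (?v E - e/2)"
        by (subst 1) (rule SUP_least, use le in \<open>auto simp: v intro!: ennreal_leI\<close>)
      moreover have "0 \<le> ?v E - e/2" using le[of "{}"] by auto
      ultimately show False using e by (simp add: v)
    qed
    then obtain K where K: "compact K" "K \<subseteq> E" "?v E - ?v K < e/2" by blast
    have "variation m E < ennreal (?v E + e/2)"
      unfolding v using e by (intro ennreal_lessI) (auto intro: add_nonneg_pos)
    then have "(INF U\<in>{U. open U \<and> E \<subseteq> U}. variation m U) < ennreal (?v E + e/2)"
      by (subst (asm) 2)
    then obtain U where U: "open U" "E \<subseteq> U" "variation m U < ennreal (?v E + e/2)"
      unfolding INF_less_iff by blast
    then have "?v U < ?v E + e/2" by (simp add: v ennreal_less_iff)
    moreover have "?v (U - K) = ?v U - ?v K"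
      using K U cb by (intro finite_measure_Diff) auto
    ultimately have "variation m (U - K) < ennreal e"
      using K e unfolding v by (intro ennreal_lessI) auto
    then show "\<exists>K U. compact K \<and> open U \<and> K \<subseteq> E \<and> E \<subseteq> U \<and> variation m (U - K) < ennreal e"
      using K U by blast
  next
    assume *: "\<forall>E\<in>sets borel. \<forall>e>0. \<exists>K U. compact K \<and> open U \<and> K \<subseteq> E \<and> E \<subseteq> U \<and>
      variation m (U - K) < ennreal e"
    show "radon m" unfolding radon_def
    proof (intro conjI ballI m)
      fix E :: "'a set" assume E: "E \<in> sets borel"
      show "variation m E = (SUP K\<in>{K. compact K \<and> K \<subseteq> E}. variation m K)"
      proof (rule antisym)
        show "variation m E \<le> (SUP K\<in>{K. compact K \<and> K \<subseteq> E}. variation m K)"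
        proof (rule ennreal_le_epsilon)
          fix e :: real assume "0 < e"
          then obtain K U where KU: "compact K" "open U" "K \<subseteq> E" "E \<subseteq> U" "variation m (U - K) < ennreal e"
            using *[rule_format, OF E \<open>0 < e\<close>] by blast
          have "variation m E \<le> variation m (K \<union> (U - K))"
            using KU E cb by (intro variation_mono[OF m]) auto
          also have "\<dots> \<le> variation m K + variation m (U - K)"
            unfolding em using KU cb by (intro emeasure_subadditive) auto
          also have "\<dots> \<le> (SUP K\<in>{K. compact K \<and> K \<subseteq> E}. variation m K) + ennreal e"
            using KU by (intro add_mono SUP_upper) auto
          finally show "variation m E \<le> (SUP K\<in>{K. compact K \<and> K \<subseteq> E}. variation m K) + ennreal e" .
        qed
        show "(SUP K\<in>{K. compact K \<and> K \<subseteq> E}. variation m K) \<le> variation m E"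
          using E cb by (intro SUP_least variation_mono[OF m]) auto
      qed
      show "variation m E = (INF U\<in>{U. open U \<and> E \<subseteq> U}. variation m U)"
      proof (rule antisym)
        show "(INF U\<in>{U. open U \<and> E \<subseteq> U}. variation m U) \<le> variation m E"
        proof (rule ennreal_le_epsilon)
          fix e :: real assume "0 < e"
          then obtain K U where KU: "compact K" "open U" "K \<subseteq> E" "E \<subseteq> U" "variation m (U - K) < ennreal e"
            using *[rule_format, OF E \<open>0 < e\<close>] by blast
          have "(INF U\<in>{U. open U \<and> E \<subseteq> U}. variation m U) \<le> variation m U"
            using KU by (intro INF_lower) auto
          also have "\<dots> \<le> variation m (E \<union> (U - K))"
            using KU E cb by (intro variation_mono[OF m]) auto
          also have "\<dots> \<le> variation m E + variation m (U - K)"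
            unfolding em using KU cb E by (intro emeasure_subadditive) auto
          also have "\<dots> \<le> variation m E + ennreal e"
            using KU by (intro add_mono) auto
          finally show "(INF U\<in>{U. open U \<and> E \<subseteq> U}. variation m U) \<le> variation m E + ennreal e" .
        qed
        show "variation m E \<le> (INF U\<in>{U. open U \<and> E \<subseteq> U}. variation m U)"
          using E by (intro INF_greatest variation_mono[OF m]) auto
      qed
    qed
  qed
qed

lemma radon_zero: "radon (\<lambda>_::'a::t2_space set. 0 :: complex)"
proof -
  have "variation (\<lambda>_::'a set. 0::complex) E = 0" for E
    using variation_scaleR[of 0 "\<lambda>_. 0" E] by simp
  then show ?thesis
    unfolding radon_iff[OF vector_measure_zero]
    by (metis compact_empty empty_subsetI ennreal_less_zero_iff open_UNIV subset_UNIV)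
qed

lemma radon_scaleR:
  fixes m :: "'a::t2_space set \<Rightarrow> complex"
  assumes "radon m" shows "radon (\<lambda>E. c *\<^sub>R m E)"
proof -
  have m: "vector_measure m" using assms by (simp add: radon_def)
  show ?thesis
    unfolding radon_iff[OF vector_measure_scaleR[OF m]]
  proof (intro ballI allI impI)
    fix E :: "'a set" and e :: real assume "E \<in> sets borel" "0 < e"
    then obtain K U where KU: "compact K" "open U" "K \<subseteq> E" "E \<subseteq> U" "variation m (U - K) < ennreal (e / (\<bar>c\<bar> + 1))"
      using assms unfolding radon_iff[OF m] by (metis abs_ge_zero add_nonneg_pos divide_pos_pos zero_less_one)
    have "variation (\<lambda>E. c *\<^sub>R m E) (U - K) \<le> ennreal (\<bar>c\<bar> + 1) * variation m (U - K)"
      unfolding variation_scaleR by (intro mult_right_mono ennreal_leI) auto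
    also have "\<dots> < ennreal (\<bar>c\<bar> + 1) * ennreal (e / (\<bar>c\<bar> + 1))"
      using KU by (intro ennreal_mult_strict_left_mono) (simp_all add: add_nonneg_pos del: ennreal_plus)
    also have "\<dots> = ennreal e"
      using \<open>0 < e\<close> by (subst ennreal_mult[symmetric]) auto
    finally show "\<exists>K U. compact K \<and> open U \<and> K \<subseteq> E \<and> E \<subseteq> U \<and> variation (\<lambda>E. c *\<^sub>R m E) (U - K) < ennreal e"
      using KU by blast
  qed
qed

lemma radon_add:
  fixes m n :: "'a::t2_space set \<Rightarrow> complex"
  assumes "radon m" "radon n" shows "radon (\<lambda>E. m E + n E)"
proof -
  have m: "vector_measure m" and n: "vector_measure n" using assms by (simp_all add: radon_def)
  show ?thesis
    unfolding radon_iff[OF vector_measure_add[OF m n]]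
  proof (intro ballI allI impI)
    fix E :: "'a set" and e :: real assume "E \<in> sets borel" "0 < e"
    then have "0 < e / 2" by simp
    obtain K U where KU: "compact K" "open U" "K \<subseteq> E" "E \<subseteq> U" "variation m (U - K) < ennreal (e/2)"
      using assms(1)[unfolded radon_iff[OF m]] \<open>E \<in> sets borel\<close> \<open>0 < e/2\<close> by meson
    obtain L V where LV: "compact L" "open V" "L \<subseteq> E" "E \<subseteq> V" "variation n (V - L) < ennreal (e/2)"
      using assms(2)[unfolded radon_iff[OF n]] \<open>E \<in> sets borel\<close> \<open>0 < e/2\<close> by meson
    have b: "K \<in> sets borel" "L \<in> sets borel" using KU LV by (simp_all add: compact_imp_closed)
    let ?D = "(U \<inter> V) - (K \<union> L)"
    have "variation (\<lambda>E. m E + n E) ?D \<le> variation m ?D + variation n ?D" by (rule variation_add_le)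
    also have "\<dots> \<le> variation m (U - K) + variation n (V - L)"
      using KU LV b by (intro add_mono variation_mono m n) auto
    also have "\<dots> < ennreal (e/2) + ennreal (e/2)"
      using KU LV by (intro add_strict_mono) auto
    also have "\<dots> = ennreal e" using \<open>0 < e\<close> by (simp add: ennreal_plus[symmetric] del: ennreal_plus)
    finally show "\<exists>K U. compact K \<and> open U \<and> K \<subseteq> E \<and> E \<subseteq> U \<and> variation (\<lambda>E. m E + n E) (U - K) < ennreal e"
      using KU LV by (intro exI[of _ "K \<union> L"] exI[of _ "U \<inter> V"]) (auto intro: compact_Un)
  qed
qed

text \<open>The space \<open>M(\<Omega>)\<close>, where \<open>\<Omega>\<close> is the whole type.\<close>

typedef (overloaded) 'a radon_measure = "{m :: 'a::t2_space set \<Rightarrow> complex. radon m}"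
  morphisms apply_radon Radon
  using radon_zero by blast

setup_lifting type_definition_radon_measure

lemma radon_apply: "radon (apply_radon \<mu>)"
  using apply_radon by blast

lemma vector_measure_apply: "vector_measure (apply_radon \<mu>)"
  using radon_apply[of \<mu>] by (simp add: radon_def)

instantiation radon_measure :: (t2_space) real_normed_vector
begin

lift_definition zero_radon_measure :: "'a radon_measure" is "\<lambda>_. 0"
  by (rule radon_zero)

lift_definition plus_radon_measure :: "'a radon_measure \<Rightarrow> 'a radon_measure \<Rightarrow> 'a radon_measure"
  is "\<lambda>m n E. m E + n E"
  by (rule radon_add)

lift_definition scaleR_radon_measure :: "real \<Rightarrow> 'a radon_measure \<Rightarrow> 'a radon_measure"
  is "\<lambda>c m E. c *\<^sub>R m E"
  by (rule radon_scaleR)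

definition uminus_radon_measure :: "'a radon_measure \<Rightarrow> 'a radon_measure"
  where "- \<mu> = (-1) *\<^sub>R \<mu>" for \<mu> :: "'a radon_measure"

definition minus_radon_measure :: "'a radon_measure \<Rightarrow> 'a radon_measure \<Rightarrow> 'a radon_measure"
  where "\<mu> - \<nu> = \<mu> + (- \<nu>)" for \<mu> \<nu> :: "'a radon_measure"

definition norm_radon_measure :: "'a radon_measure \<Rightarrow> real"
  where "norm \<mu> = enn2real (variation (apply_radon \<mu>) UNIV)"

definition sgn_radon_measure :: "'a radon_measure \<Rightarrow> 'a radon_measure"
  where "sgn \<mu> = inverse (norm \<mu>) *\<^sub>R \<mu>" for \<mu> :: "'a radon_measure"

definition dist_radon_measure :: "'a radon_measure \<Rightarrow> 'a radon_measure \<Rightarrow> real"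
  where "dist \<mu> \<nu> = norm (\<mu> - \<nu>)" for \<mu> \<nu> :: "'a radon_measure"

definition uniformity_radon_measure :: "('a radon_measure \<times> 'a radon_measure) filter"
  where "uniformity_radon_measure =
    (INF e\<in>{0 <..}. principal {(\<mu>, \<nu>). dist \<mu> \<nu> < e})"

definition open_radon_measure :: "'a radon_measure set \<Rightarrow> bool"
  where "open_radon_measure U =
    (\<forall>\<mu>\<in>U. eventually (\<lambda>(\<mu>', \<nu>). \<mu>' = \<mu> \<longrightarrow> \<nu> \<in> U) uniformity)"

instance
proof
  note ops = zero_radon_measure.rep_eq plus_radon_measure.rep_eq scaleR_radon_measure.rep_eq
    uminus_radon_measure_def
  have eq: "\<mu> = \<nu> \<longleftrightarrow> (\<forall>E. apply_radon \<mu> E = apply_radon \<nu> E)" for \<mu> \<nu> :: "'a radon_measure"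
    by (simp add: fun_eq_iff flip: apply_radon_inject)
  fix \<mu> \<nu> \<rho> :: "'a radon_measure" and a b :: real
  show "\<mu> + \<nu> + \<rho> = \<mu> + (\<nu> + \<rho>)" "\<mu> + \<nu> = \<nu> + \<mu>" "0 + \<mu> = \<mu>"
    by (simp_all add: eq ops algebra_simps)
  show "- \<mu> + \<mu> = 0"
    by (simp add: eq ops)
  show "\<mu> - \<nu> = \<mu> + - \<nu>"
    by (rule minus_radon_measure_def)
  show "a *\<^sub>R (\<mu> + \<nu>) = a *\<^sub>R \<mu> + a *\<^sub>R \<nu>" "(a + b) *\<^sub>R \<mu> = a *\<^sub>R \<mu> + b *\<^sub>R \<mu>"
    "a *\<^sub>R b *\<^sub>R \<mu> = (a * b) *\<^sub>R \<mu>" "1 *\<^sub>R \<mu> = \<mu>"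
    by (simp_all add: eq ops algebra_simps)
  show "(norm \<mu> = 0) = (\<mu> = 0)"
  proof
    assume "norm \<mu> = 0"
    then have 0: "variation (apply_radon \<mu>) UNIV = 0"
      using variation_finite[OF vector_measure_apply, of \<mu> UNIV]
      by (auto simp: norm_radon_measure_def enn2real_eq_0_iff)
    have "apply_radon \<mu> E = 0" for E
    proof (cases "E \<in> sets borel")
      case True
      then have "ennreal (norm (apply_radon \<mu> E)) \<le> variation (apply_radon \<mu>) UNIV"
        using norm_le_variation variation_mono[OF vector_measure_apply, of E UNIV \<mu>]
        by (meson order_trans sets.top space_borel subset_UNIV borel_open open_UNIV)
      then show ?thesis by (simp add: 0)
    next
      case False
      then show ?thesis using vector_measure_nonborel[OF vector_measure_apply] by blast
    qed
    then show "\<mu> = 0"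
      by (simp add: eq ops)
  next
    assume "\<mu> = 0"
    then show "norm \<mu> = 0"
      using variation_scaleR[of 0 "\<lambda>_. 0::complex" "UNIV :: 'a set"]
      by (simp add: norm_radon_measure_def zero_radon_measure.rep_eq)
  qed
  show "norm (\<mu> + \<nu>) \<le> norm \<mu> + norm \<nu>"
  proof -
    have fin: "variation (apply_radon \<mu>) UNIV < top" for \<mu> :: "'a radon_measure"
      using variation_finite[OF vector_measure_apply] by (simp add: infinity_ennreal_def)
    have "norm (\<mu> + \<nu>) \<le> enn2real (variation (apply_radon \<mu>) UNIV + variation (apply_radon \<nu>) UNIV)"
      unfolding norm_radon_measure_def plus_radon_measure.rep_eq
      by (rule enn2real_mono[OF variation_add_le]) (use fin in simp)
    also have "\<dots> = norm \<mu> + norm \<nu>"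
      unfolding norm_radon_measure_def by (rule enn2real_plus[OF fin fin])
    finally show ?thesis .
  qed
  show "norm (a *\<^sub>R \<mu>) = \<bar>a\<bar> * norm \<mu>"
    by (simp add: norm_radon_measure_def scaleR_radon_measure.rep_eq variation_scaleR enn2real_mult)
qed (simp_all add: sgn_radon_measure_def dist_radon_measure_def
      uniformity_radon_measure_def open_radon_measure_def)

end

text \<open>The positive part \<open>(|\<nu>| + \<nu>) / 2\<close> of the Jordan decomposition of a finite signed measure; the
  negative part of \<open>\<nu>\<close> is the positive part of \<open>- \<nu>\<close>.\<close>

definition upper_variation :: "('a::topological_space set \<Rightarrow> real) \<Rightarrow> 'a measure" where
  "upper_variation \<nu> = measure_of UNIV (sets borel)
    (\<lambda>E. ennreal ((enn2real (variation \<nu> E) + \<nu> E) / 2))"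

lemma emeasure_upper_variation:
  assumes v: "vector_measure \<nu>" and fin: "variation \<nu> UNIV < \<infinity>" and E: "E \<in> sets borel"
  shows "emeasure (upper_variation \<nu>) E = ennreal ((enn2real (variation \<nu> E) + \<nu> E) / 2)"
proof (rule emeasure_measure_of[OF upper_variation_def])
  have sets: "sets (upper_variation \<nu>) = sets borel"
    by (metis sets.sets_measure_of_eq space_borel upper_variation_def)
  interpret finite_measure "variation_measure \<nu>"
    using fin by (intro finite_measureI) (simp add: emeasure_variation_measure[OF v])
  have m: "enn2real (variation \<nu> E) = measure (variation_measure \<nu>) E" for E
    by (simp add: measure_def emeasure_variation_measure[OF v])
  have nonneg: "0 \<le> (enn2real (variation \<nu> E) + \<nu> E) / 2" if "E \<in> sets borel" for E
    using norm_le_variation[OF that, of \<nu>]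
    by (simp add: m emeasure_eq_measure flip: emeasure_variation_measure[OF v])
  show "E \<in> sets (upper_variation \<nu>)" by (simp add: sets E)
  show "positive (sets (upper_variation \<nu>)) (\<lambda>E. ennreal ((enn2real (variation \<nu> E) + \<nu> E) / 2))"
    by (simp add: positive_def variation_empty[OF v] vector_measure_empty[OF v])
  show "countably_additive (sets (upper_variation \<nu>))
      (\<lambda>E. ennreal ((enn2real (variation \<nu> E) + \<nu> E) / 2))"
    unfolding countably_additive_def sets
  proof (intro allI impI)
    fix A :: "nat \<Rightarrow> 'a set"
    assume A: "range A \<subseteq> sets borel" "disjoint_family A"
    have "(\<lambda>n. (measure (variation_measure \<nu>) (A n) + \<nu> (A n)) / 2) sums
        ((measure (variation_measure \<nu>) (\<Union>n. A n) + \<nu> (\<Union>n. A n)) / 2)"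
      using A by (intro sums_divide sums_add vector_measureD[OF v] finite_measure_UNION) auto
    moreover have "0 \<le> (enn2real (variation \<nu> (A n)) + \<nu> (A n)) / 2" for n
      using A by (intro nonneg) auto
    ultimately show "(\<Sum>n. ennreal ((enn2real (variation \<nu> (A n)) + \<nu> (A n)) / 2)) =
        ennreal ((enn2real (variation \<nu> (\<Union>n. A n)) + \<nu> (\<Union>n. A n)) / 2)"
      unfolding m by (subst suminf_ennreal2) (simp_all only: sums_iff)
  qed
qed auto

definition radon_integral :: "'a::t2_space radon_measure \<Rightarrow> ('a \<Rightarrow> complex) \<Rightarrow> complex" where
  "radon_integral \<mu> f =
    (\<integral>x. f x \<partial>upper_variation (\<lambda>E. Re (apply_radon \<mu> E))) -
    (\<integral>x. f x \<partial>upper_variation (\<lambda>E. - Re (apply_radon \<mu> E))) +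
    \<i> * ((\<integral>x. f x \<partial>upper_variation (\<lambda>E. Im (apply_radon \<mu> E))) -
         (\<integral>x. f x \<partial>upper_variation (\<lambda>E. - Im (apply_radon \<mu> E))))"

definition C0 :: "('a::topological_space \<Rightarrow> complex) set" where
  "C0 = {f. continuous_on UNIV f \<and> (\<forall>e>0. compact {x. e \<le> norm (f x)})}"

text \<open>The adjoint of an operator \<open>A\<close> on \<open>C\<^sub>0(\<Omega>)\<close>, acting on \<open>M(\<Omega>)\<close>: on a locally compact Hausdorff space
  the Riesz representation theorem yields, for bounded \<open>A\<close>, exactly one Radon measure that
  represents the functional \<open>f \<mapsto> \<integral> A f d\<mu>\<close>.\<close>

definition radon_adjoint ::
  "(('a::t2_space \<Rightarrow> complex) \<Rightarrow> 'a \<Rightarrow> complex) \<Rightarrow> 'a radon_measure \<Rightarrow> 'a radon_measure" where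
  "radon_adjoint A \<mu> = (THE \<nu>. \<forall>f\<in>C0. radon_integral \<nu> f = radon_integral \<mu> (A f))"

definition wcomp :: "('a \<Rightarrow> 'a) \<Rightarrow> ('a \<Rightarrow> real) \<Rightarrow> ('a \<Rightarrow> complex) \<Rightarrow> 'a \<Rightarrow> complex" where
  "wcomp \<alpha> w f = (\<lambda>x. of_real (w x) * f (\<alpha> x))"

definition wcomp_inv :: "('a \<Rightarrow> 'a) \<Rightarrow> ('a \<Rightarrow> real) \<Rightarrow> ('a \<Rightarrow> complex) \<Rightarrow> 'a \<Rightarrow> complex" where
  "wcomp_inv \<alpha> w f = (\<lambda>x. f (inv \<alpha> x) / of_real (w (inv \<alpha> x)))"

definition wcomp_adj ::
  "('a::t2_space \<Rightarrow> 'a) \<Rightarrow> ('a \<Rightarrow> real) \<Rightarrow> 'a radon_measure \<Rightarrow> 'a radon_measure" where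
  "wcomp_adj \<alpha> w = radon_adjoint (wcomp \<alpha> w)"

definition wcomp_inv_adj ::
  "('a::t2_space \<Rightarrow> 'a) \<Rightarrow> ('a \<Rightarrow> real) \<Rightarrow> 'a radon_measure \<Rightarrow> 'a radon_measure" where
  "wcomp_inv_adj \<alpha> w = radon_adjoint (wcomp_inv \<alpha> w)"

definition cosine_adj ::
  "('a::t2_space \<Rightarrow> 'a) \<Rightarrow> ('a \<Rightarrow> real) \<Rightarrow> nat \<Rightarrow> 'a radon_measure \<Rightarrow> 'a radon_measure" where
  "cosine_adj \<alpha> w n \<mu> =
    (1 / 2) *\<^sub>R ((wcomp_adj \<alpha> w ^^ n) \<mu> + (wcomp_inv_adj \<alpha> w ^^ n) \<mu>)"

definition aperiodic :: "('a::topological_space \<Rightarrow> 'a) \<Rightarrow> bool" where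
  "aperiodic \<alpha> \<longleftrightarrow> (\<forall>K. compact K \<longrightarrow> (\<exists>N>0. \<forall>n\<ge>N. K \<inter> (\<alpha> ^^ n) ` K = {}))"

text \<open>Sequences of operators are indexed by \<open>n \<ge> 1\<close>; the operator at index \<open>0\<close> plays no role below.\<close>

definition topologically_transitive :: "(nat \<Rightarrow> 'x::real_normed_vector \<Rightarrow> 'x) \<Rightarrow> bool" where
  "topologically_transitive T \<longleftrightarrow>
    (\<forall>U V. open U \<and> U \<noteq> {} \<and> open V \<and> V \<noteq> {} \<longrightarrow> (\<exists>n\<ge>1. T n ` U \<inter> V \<noteq> {}))"

definition periodic_elements :: "(nat \<Rightarrow> 'x::real_normed_vector \<Rightarrow> 'x) \<Rightarrow> 'x set" where
  "periodic_elements T = {x. \<exists>N\<ge>1. \<forall>k\<ge>1. T (k * N) x = x}"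

definition chaotic :: "(nat \<Rightarrow> 'x::real_normed_vector \<Rightarrow> 'x) \<Rightarrow> bool" where
  "chaotic T \<longleftrightarrow> topologically_transitive T \<and> closure (periodic_elements T) = UNIV"

text \<open>Supremum of a nonnegative function, with value \<open>0\<close> on the empty set.\<close>

definition sup0 :: "'a set \<Rightarrow> ('a \<Rightarrow> real) \<Rightarrow> real" where
  "sup0 S f = (if S = {} then 0 else (SUP t\<in>S. f t))"

end

theory Submission
  imports Defs
begin

text \<open>The adjoint of \<open>T f = w (f \<circ> \<alpha>)\<close> sends \<open>\<mu>\<close> to the image of \<open>w d\<mu>\<close> under \<open>\<alpha>\<close>, so its \<open>n\<close>-th power is
  the image under \<open>\<alpha>\<^sup>n\<close> with density \<open>\<Prod>j<n. w \<circ> \<alpha>\<^sup>j\<close>. If this density is at most \<open>C\<close> on a Borel set \<open>D\<close>,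
  then, on measures carried by \<open>D\<close>, the power has norm at most \<open>4 C\<close>; the \<open>4\<close> is the price for splitting
  a complex measure into four positive parts. Given \<open>\<mu>\<close> and \<open>\<nu>\<close>, apply the hypothesis to the restriction of
  \<open>|\<mu>| + |\<nu>|\<close> to a large compact \<open>K\<close>: for \<open>D = K - A\<^sub>k\<close> with \<open>k\<close> large, the restrictions of \<open>\<mu>\<close> and \<open>\<nu>\<close> to \<open>D\<close>
  are close to \<open>\<mu>\<close> and \<open>\<nu>\<close>, and their forward and backward orbits along the multiples of \<open>n\<^sub>k\<close> have small
  norm sums. Hence a bilateral sum along such an orbit is a nearby periodic point.\<close>

section \<open>Integration against complex Radon measures\<close>

text \<open>The sequence \<open>s\<close> is chosen from \<open>f\<close> alone, so it serves every
  finite Borel measure at once. This uniformity lets linear relations between measures pass to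
  integrals.\<close>

lemma simple_measure_sum_tendsto_integral:
  fixes f :: "'a::topological_space \<Rightarrow> complex"
  assumes f: "f \<in> borel_measurable borel" and bd: "bounded (range f)"
  obtains s :: "nat \<Rightarrow> 'a \<Rightarrow> complex"
  where "\<And>n. simple_function borel (s n)"
    and "\<And>P. finite_measure P \<Longrightarrow> sets P = sets borel \<Longrightarrow>
      (\<lambda>n. \<Sum>y\<in>range (s n). y * of_real (measure P (s n -` {y}))) \<longlonglongrightarrow> (\<integral>x. f x \<partial>P)"
proof -
  from borel_measurable_implies_sequence_metric[OF f, of 0]
  obtain s :: "nat \<Rightarrow> 'a \<Rightarrow> complex" where simple: "\<And>n. simple_function borel (s n)"
    and lim: "\<And>x. (\<lambda>n. s n x) \<longlonglongrightarrow> f x"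
    and le: "\<And>n x. norm (s n x) \<le> 2 * norm (f x)"
    by auto
  obtain b where b: "\<And>x. norm (f x) \<le> b"
    using bd by (auto simp: bounded_iff)
  show thesis
  proof (rule that[OF simple])
    fix P :: "'a measure"
    assume "finite_measure P" and sets: "sets P = sets borel"
    then interpret finite_measure P by simp
    have space: "space P = UNIV" using sets_eq_imp_space_eq[OF sets] by simp
    have meas: "borel_measurable P = (borel_measurable borel :: ('a \<Rightarrow> complex) set)"
      by (rule measurable_cong_sets[OF sets refl])
    have s_P: "simple_function P (s n)" for n
      using simple[of n] by (simp add: simple_function_def space sets)
    \<comment> \<open>The approximants satisfy |s n| <= 2|f| <= 2b, and the constant
      \<open>2 * b\<close> is integrable because \<open>P\<close> is finite.\<close>
    have "(\<lambda>n. \<integral>x. s n x \<partial>P) \<longlonglongrightarrow> (\<integral>x. f x \<partial>P)"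
    proof (rule integral_dominated_convergence[where w = "\<lambda>_. 2 * b"])
      show "AE x in P. norm (s n x) \<le> 2 * b" for n
        using le b by (intro AE_I2) (meson mult_left_mono order_trans zero_le_numeral)
    qed (use f lim borel_measurable_simple_function[OF simple] in \<open>auto simp: meas\<close>)
    moreover have "(\<integral>x. s n x \<partial>P) = (\<Sum>y\<in>range (s n). y * of_real (measure P (s n -` {y})))" for n
    proof -
      have "Bochner_Integration.simple_bochner_integrable P (s n)"
        by (rule Bochner_Integration.simple_bochner_integrable.intros[OF s_P]) simp
      then show ?thesis
        by (simp add: simple_bochner_integrable_eq_integral[symmetric] Bochner_Integration.simple_bochner_integral_def space
          vimage_def scaleR_conv_of_real mult.commute)
    qed
    ultimately show "(\<lambda>n. \<Sum>y\<in>range (s n). y * of_real (measure P (s n -` {y}))) \<longlonglongrightarrow> (\<integral>x. f x \<partial>P)"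
      by simp
  qed
qed

text \<open>Positive parts need not depend additively on a measure, so relations between integrals
  are derived from relations between values: first for simple functions, then in the limit along the
  common sequence.\<close>

lemma sum_integral_eqI:
  fixes f :: "'a::topological_space \<Rightarrow> complex"
  assumes f: "f \<in> borel_measurable borel" "bounded (range f)"
    and P: "\<And>i. i \<in> I \<Longrightarrow> finite_measure (P i)" "\<And>i. i \<in> I \<Longrightarrow> sets (P i) = sets borel"
    and Q: "\<And>j. j \<in> J \<Longrightarrow> finite_measure (Q j)" "\<And>j. j \<in> J \<Longrightarrow> sets (Q j) = sets borel"
    and eq: "\<And>E. E \<in> sets borel \<Longrightarrow>
      (\<Sum>i\<in>I. c i * of_real (measure (P i) E)) = (\<Sum>j\<in>J. d j * of_real (measure (Q j) E))"
  shows "(\<Sum>i\<in>I. c i * (\<integral>x. f x \<partial>P i)) = (\<Sum>j\<in>J. d j * (\<integral>x. f x \<partial>Q j))"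
proof -
  obtain s :: "nat \<Rightarrow> 'a \<Rightarrow> complex" where simple: "\<And>n. simple_function borel (s n)"
    and lim: "\<And>P. finite_measure P \<Longrightarrow> sets P = sets borel \<Longrightarrow>
      (\<lambda>n. \<Sum>y\<in>range (s n). y * of_real (measure P (s n -` {y}))) \<longlonglongrightarrow> (\<integral>x. f x \<partial>P)"
    using simple_measure_sum_tendsto_integral[OF f] by blast
  have borel: "s n -` {y} \<in> sets borel" for n y
    using simple_functionD(2)[OF simple, of n "{y}"] by simp
  have "(\<lambda>n. \<Sum>i\<in>I. c i * (\<Sum>y\<in>range (s n). y * of_real (measure (P i) (s n -` {y}))))
      \<longlonglongrightarrow> (\<Sum>i\<in>I. c i * (\<integral>x. f x \<partial>P i))"
    using P by (intro tendsto_sum tendsto_mult_left lim)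
  moreover have "(\<lambda>n. \<Sum>j\<in>J. d j * (\<Sum>y\<in>range (s n). y * of_real (measure (Q j) (s n -` {y}))))
      \<longlonglongrightarrow> (\<Sum>j\<in>J. d j * (\<integral>x. f x \<partial>Q j))"
    using Q by (intro tendsto_sum tendsto_mult_left lim)
  \<comment> \<open>Swapping the sums brings the value \<open>y\<close> outside; \<open>eq\<close>
    then applies to the level set of \<open>y\<close>.\<close>
  moreover have "(\<Sum>i\<in>I. c i * (\<Sum>y\<in>range (s n). y * of_real (measure (P i) (s n -` {y})))) =
    (\<Sum>j\<in>J. d j * (\<Sum>y\<in>range (s n). y * of_real (measure (Q j) (s n -` {y}))))" for n
    using eq[OF borel]
    by (simp add: sum_distrib_left) (subst (1 2) sum.swap,
      simp add: mult.left_commute[of "c _"] mult.left_commute[of "d _"] flip: sum_distrib_left)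
  ultimately show ?thesis
    by (simp add: LIMSEQ_unique)
qed

section \<open>The four positive parts of a complex Radon measure\<close>

text \<open>The fourth roots of unity, collected in a set so that the four terms of
  \<open>radon_integral\<close> become one indexed sum.\<close>

definition quarter_units :: "complex set" where
  "quarter_units = {1, -1, \<i>, -\<i>}"

text \<open>For \<open>c = 1, -1, \<i>, -\<i>\<close> these are the four positive measures in the definition of
  \<open>radon_integral\<close>, so that \<open>\<mu>\<close> is the sum of \<open>c\<close> times its \<open>c\<close>-part.\<close>

definition radon_part :: "complex \<Rightarrow> 'a::t2_space radon_measure \<Rightarrow> 'a measure" where
  "radon_part c \<mu> = upper_variation (\<lambda>E. Re (cnj c * apply_radon \<mu> E))"

lemma finite_quarter_units [simp]: "finite quarter_units"
  and card_quarter_units: "card quarter_units = 4"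
  and norm_quarter_units: "c \<in> quarter_units \<Longrightarrow> norm c = 1"
  by (auto simp: quarter_units_def card_insert_if complex_eq_iff[of "- 1" \<i>] complex_eq_iff[of 1] complex_eq_iff[of \<i>])

lemma sum_quarter_units:
  "(\<Sum>c\<in>quarter_units. g c) = g 1 + g (-1) + g \<i> + g (-\<i>)" for g :: "complex \<Rightarrow> 'b::comm_monoid_add"
  by (simp add: quarter_units_def complex_eq_iff add.assoc)

lemma variation_eq_measure:
  "variation (apply_radon \<mu>) E = ennreal (measure (variation_measure (apply_radon \<mu>)) E)"
  by (metis emeasure_variation_measure finite_measure.emeasure_eq_measure finite_measure_variation
      vector_measure_apply)

lemma sets_upper_variation [simp]: "sets (upper_variation \<nu>) = sets borel"
  by (metis sets.sets_measure_of_eq space_borel upper_variation_def)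

lemma variation_mono_norm:
  assumes "\<And>B. norm (m B) \<le> norm (n B)"
  shows "variation m E \<le> variation n E"
  unfolding variation_def by (intro SUP_mono') (use assms in \<open>auto intro!: sum_mono ennreal_leI\<close>)

text \<open>With \<nu> = Re (cnj c * \<mu>) and |c| = 1, one has |\<nu>(E)| <= |\<nu>|(E) <=
  |\<mu>|(E). Hence (|\<nu>| + \<nu>) / 2 is nonnegative, so the conversion to
  \<open>ennreal\<close> truncates nothing, and it is at most |\<mu>|.\<close>

lemma measure_radon_part:
  assumes c: "norm c = 1" and E: "E \<in> sets borel"
  shows "measure (radon_part c \<mu>) E =
      (enn2real (variation (\<lambda>E. Re (cnj c * apply_radon \<mu> E)) E) + Re (cnj c * apply_radon \<mu> E)) / 2"
    and "emeasure (radon_part c \<mu>) E \<le> variation (apply_radon \<mu>) E"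
    and "finite_measure (radon_part c \<mu>)"
proof -
  let ?\<nu> = "\<lambda>E. Re (cnj c * apply_radon \<mu> E)"
  have v: "vector_measure ?\<nu>"
    using vector_measure_apply[of \<mu>] unfolding vector_measure_def
    by (auto intro!: sums_Re sums_mult simp del: complex_cnj_mult times_complex.sel)
  have le: "variation ?\<nu> F \<le> variation (apply_radon \<mu>) F" for F
  proof (rule variation_mono_norm)
    show "norm (?\<nu> B) \<le> norm (apply_radon \<mu> B)" for B
      using abs_Re_le_cmod[of "cnj c * apply_radon \<mu> B"] c by (simp add: norm_mult)
  qed
  have fin: "variation ?\<nu> F < \<infinity>" for F
    using le[of F] variation_finite[OF vector_measure_apply, of \<mu> F] by (rule le_less_trans)
  have em: "emeasure (radon_part c \<mu>) F = ennreal ((enn2real (variation ?\<nu> F) + ?\<nu> F) / 2)"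
    if "F \<in> sets borel" for F
    unfolding radon_part_def by (rule emeasure_upper_variation[OF v fin that])
  have abs_le: "\<bar>?\<nu> F\<bar> \<le> enn2real (variation ?\<nu> F)" if "F \<in> sets borel" for F
  proof -
    have "ennreal \<bar>?\<nu> F\<bar> \<le> variation ?\<nu> F"
      using norm_le_variation[OF that, of ?\<nu>] by simp
    then show ?thesis using fin[of F] by (metis enn2real_ennreal enn2real_mono abs_ge_zero infinity_ennreal_def)
  qed
  show "measure (radon_part c \<mu>) E = (enn2real (variation ?\<nu> E) + ?\<nu> E) / 2"
    unfolding measure_def em[OF E] using abs_le[OF E] by (intro enn2real_ennreal) simp
  have "ennreal ((enn2real (variation ?\<nu> E) + ?\<nu> E) / 2) \<le> ennreal (enn2real (variation ?\<nu> E))"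
    using abs_le[OF E] by (intro ennreal_leI) simp
  also have "\<dots> = variation ?\<nu> E"
    using fin[of E] by (simp add: ennreal_enn2real_if)
  finally show "emeasure (radon_part c \<mu>) E \<le> variation (apply_radon \<mu>) E"
    unfolding em[OF E] using le order_trans by blast
  have "space (radon_part c \<mu>) = UNIV"
    using sets_eq_imp_space_eq[OF sets_upper_variation] by (simp add: radon_part_def)
  then show "finite_measure (radon_part c \<mu>)"
    by (intro finite_measureI) (simp add: em)
qed

lemma sets_radon_part [simp]: "sets (radon_part c \<mu>) = sets borel"
  by (simp add: radon_part_def)

lemma space_radon_part [simp]: "space (radon_part c \<mu>) = UNIV"
  using sets_eq_imp_space_eq[OF sets_radon_part] by simp

lemma finite_measure_radon_part: "c \<in> quarter_units \<Longrightarrow> finite_measure (radon_part c \<mu>)"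
  by (rule measure_radon_part(3)[of _ "{}"]) (simp_all add: norm_quarter_units)

lemma apply_radon_eq_sum:
  "apply_radon \<mu> E = (\<Sum>c\<in>quarter_units. c * of_real (measure (radon_part c \<mu>) E))"
proof (cases "E \<in> sets borel")
  case True
  \<comment> \<open>The parts for c and -c have equal variation terms; these cancel in the
    difference and leave Re (cnj c * \<mu>).\<close>
  have neg: "variation (\<lambda>E. - n E) E = variation n E" for n :: "'a set \<Rightarrow> real"
    by (simp add: variation_def)
  show ?thesis
    by (simp add: sum_quarter_units measure_radon_part(1) True neg complex_eq_iff) (simp add: field_simps)
next
  case False
  then show ?thesis
    by (simp add: vector_measure_nonborel[OF vector_measure_apply] measure_notin_sets)
qed

lemma radon_integral_eq_sum:
  "radon_integral \<mu> f = (\<Sum>c\<in>quarter_units. c * (\<integral>x. f x \<partial>radon_part c \<mu>))"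
  by (simp add: sum_quarter_units radon_part_def radon_integral_def algebra_simps)

text \<open>Frees computations from the canonical parts: any representation of \<open>\<mu>\<close>
  by finite positive measures gives the same integral. Linearity and change of variables rest on
  this.\<close>

lemma radon_integral_eqI:
  fixes f :: "'a::t2_space \<Rightarrow> complex"
  assumes f: "f \<in> borel_measurable borel" "bounded (range f)"
    and P: "\<And>i. i \<in> I \<Longrightarrow> finite_measure (P i)" "\<And>i. i \<in> I \<Longrightarrow> sets (P i) = sets borel"
    and eq: "\<And>E. E \<in> sets borel \<Longrightarrow>
      apply_radon \<mu> E = (\<Sum>i\<in>I. c i * of_real (measure (P i) E))"
  shows "radon_integral \<mu> f = (\<Sum>i\<in>I. c i * (\<integral>x. f x \<partial>P i))"
  unfolding radon_integral_eq_sum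
  by (rule sum_integral_eqI[OF f finite_measure_radon_part _ P])
    (simp_all add: eq flip: apply_radon_eq_sum)

lemma radon_integral_indicator:
  assumes "E \<in> sets borel"
  shows "radon_integral \<mu> (indicator E) = apply_radon \<mu> E"
  unfolding radon_integral_eq_sum apply_radon_eq_sum
proof (intro sum.cong refl arg_cong2[where f="(*)"])
  fix c assume "c \<in> quarter_units"
  then interpret finite_measure "radon_part c \<mu>" by (rule finite_measure_radon_part)
  have "(\<lambda>x. indicator E x *\<^sub>R (1::complex)) = indicator E"
    by (auto simp: indicator_def)
  then show "(\<integral>x. indicator E x \<partial>radon_part c \<mu>) = complex_of_real (measure (radon_part c \<mu>) E)"
    using has_bochner_integral_indicator[of E "radon_part c \<mu>" "1::complex"] assms
    by (simp add: has_bochner_integral_iff less_top[symmetric] of_real_def)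
qed

lemma radon_integral_add:
  assumes f: "f \<in> borel_measurable borel" "bounded (range f)"
  shows "radon_integral (\<mu> + \<nu>) f = radon_integral \<mu> f + radon_integral \<nu> f"
proof -
  \<comment> \<open>The parts of a sum need not be the sums of the parts, so the eight parts
    together, indexed by a disjoint sum, represent \<open>\<mu> + \<nu>\<close>.\<close>
  let ?P = "case_sum (\<lambda>c. radon_part c \<mu>) (\<lambda>c. radon_part c \<nu>)"
  have "radon_integral (\<mu> + \<nu>) f =
      (\<Sum>i\<in>quarter_units <+> quarter_units. case_sum id id i * (\<integral>x. f x \<partial>?P i))"
    by (rule radon_integral_eqI[OF f])
      (auto simp: plus_radon_measure.rep_eq sum.Plus apply_radon_eq_sum finite_measure_radon_part)
  then show ?thesis
    by (simp add: sum.Plus radon_integral_eq_sum)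
qed

lemma radon_integral_scaleR:
  assumes f: "f \<in> borel_measurable borel" "bounded (range f)"
  shows "radon_integral (r *\<^sub>R \<mu>) f = r *\<^sub>R radon_integral \<mu> f"
proof -
  have "radon_integral (r *\<^sub>R \<mu>) f =
      (\<Sum>c\<in>quarter_units. (of_real r * c) * (\<integral>x. f x \<partial>radon_part c \<mu>))"
    by (rule radon_integral_eqI[OF f])
      (auto simp: scaleR_radon_measure.rep_eq apply_radon_eq_sum finite_measure_radon_part
        sum_distrib_left scaleR_conv_of_real mult.assoc)
  then show ?thesis
    by (simp add: radon_integral_eq_sum scaleR_conv_of_real sum_distrib_left mult.assoc)
qed

section \<open>Weighted images of Radon measures\<close>

lemma radon_measure_eqI:
  assumes "\<And>E. E \<in> sets borel \<Longrightarrow> apply_radon \<mu> E = apply_radon \<nu> E"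
  shows "\<mu> = \<nu>"
proof -
  have "apply_radon \<mu> E = apply_radon \<nu> E" for E
    using assms[of E] vector_measure_nonborel[OF vector_measure_apply] by metis
  then show ?thesis by (simp add: fun_eq_iff flip: apply_radon_inject)
qed

lemma vector_measure_sum_measures:
  fixes c :: "'i \<Rightarrow> complex" and P :: "'i \<Rightarrow> 'a::topological_space measure"
  assumes "\<And>i. i \<in> I \<Longrightarrow> finite_measure (P i)" "\<And>i. i \<in> I \<Longrightarrow> sets (P i) = sets borel"
  shows "vector_measure (\<lambda>E. \<Sum>i\<in>I. c i * of_real (measure (P i) E))"
  unfolding vector_measure_def
proof (intro conjI allI impI)
  fix A :: "nat \<Rightarrow> 'a set" assume A: "range A \<subseteq> sets borel" "disjoint_family A"
  show "(\<lambda>n. \<Sum>i\<in>I. c i * of_real (measure (P i) (A n))) sums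
      (\<Sum>i\<in>I. c i * of_real (measure (P i) (\<Union>n. A n)))"
    by (intro sums_sum sums_mult sums_of_real finite_measure.finite_measure_UNION)
      (use A assms in auto)
next
  fix E :: "'a set" assume "E \<notin> sets borel"
  then show "(\<Sum>i\<in>I. c i * of_real (measure (P i) E)) = 0"
    using assms(2) by (intro sum.neutral) (simp add: measure_notin_sets)
qed

text \<open>A partition sum of the norms is at most the sum of \<open>N\<close> over the same cells,
  which is \<open>N E\<close> by additivity.\<close>

lemma variation_le_emeasure:
  assumes sets: "sets N = sets borel"
    and le: "\<And>B. B \<in> sets borel \<Longrightarrow> ennreal (norm (m B)) \<le> emeasure N B"
  shows "variation m E \<le> emeasure N E"
  unfolding variation_def
proof (rule SUP_least)
  fix P assume P: "P \<in> borel_partitions E"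
  have "(\<Sum>B\<in>P. ennreal (norm (m B))) \<le> (\<Sum>B\<in>P. emeasure N B)"
    using P le by (intro sum_mono) (auto simp: borel_partitions_def)
  also have "\<dots> = emeasure N (\<Union>B\<in>P. B)"
    using P sets by (intro sum_emeasure) (auto simp: borel_partitions_def disjoint_family_on_def disjoint_def)
  also have "(\<Union>B\<in>P. B) = E"
    using P by (auto simp: borel_partitions_def)
  finally show "(\<Sum>B\<in>P. ennreal (norm (m B))) \<le> emeasure N E" .
qed

section \<open>Weighted images: norm estimates and regularity\<close>

text \<open>A homeomorphism transports compact and open sets, hence Radon regularity; nonnegativity
  makes \<open>v\<close> a density, and boundedness keeps the image finite. The weight is only asked
  to be measurable, so that indicators qualify.\<close>

definition push_data :: "('a::t2_space \<Rightarrow> 'a) \<Rightarrow> ('a \<Rightarrow> real) \<Rightarrow> bool" where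
  "push_data \<beta> v \<longleftrightarrow> homeomorphism UNIV UNIV \<beta> (inv \<beta>) \<and> v \<in> borel_measurable borel \<and>
    (\<forall>x. 0 \<le> v x) \<and> bounded (range v)"

definition push_part ::
  "('a::t2_space \<Rightarrow> 'a) \<Rightarrow> ('a \<Rightarrow> real) \<Rightarrow> complex \<Rightarrow> 'a radon_measure \<Rightarrow> 'a measure" where
  "push_part \<beta> v c \<mu> = distr (density (radon_part c \<mu>) (\<lambda>x. ennreal (v x))) borel \<beta>"

text \<open>The image under \<open>\<beta>\<close> of the measure \<open>v d\<mu>\<close>. The adjoints of both composition operators, all their
  powers, and the restrictions of a measure to Borel sets (\<open>\<beta> = id\<close>, \<open>v\<close> an indicator) have this form.\<close>

definition weighted_push ::
  "('a::t2_space \<Rightarrow> 'a) \<Rightarrow> ('a \<Rightarrow> real) \<Rightarrow> 'a radon_measure \<Rightarrow> 'a radon_measure" where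
  "weighted_push \<beta> v \<mu> = Radon (\<lambda>E. \<Sum>c\<in>quarter_units. c * of_real (measure (push_part \<beta> v c \<mu>) E))"

lemma sets_push_part [simp]: "sets (push_part \<beta> v c \<mu>) = sets borel"
  by (simp add: push_part_def)

lemma space_push_part [simp]: "space (push_part \<beta> v c \<mu>) = UNIV"
  by (simp add: push_part_def)

lemma measurable_radon_part_iff [simp]:
  "f \<in> measurable (radon_part c \<mu>) N \<longleftrightarrow> f \<in> measurable borel N"
  using measurable_cong_sets[OF sets_radon_part refl] by blast

lemma push_data_measurable:
  assumes "push_data \<beta> v"
  shows "\<beta> \<in> borel_measurable borel" "v \<in> borel_measurable borel" "E \<in> sets borel \<Longrightarrow> \<beta> -` E \<in> sets borel"
proof -
  show \<beta>: "\<beta> \<in> borel_measurable borel"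
    using assms by (auto simp: push_data_def homeomorphism_def intro: borel_measurable_continuous_onI)
  show "v \<in> borel_measurable borel"
    using assms by (simp add: push_data_def)
  show "\<beta> -` E \<in> sets borel" if "E \<in> sets borel"
    using measurable_sets[OF \<beta> that] by simp
qed

lemma push_data_bij:
  assumes "push_data \<beta> v"
  shows "bij \<beta>" "\<beta> (inv \<beta> x) = x" "inv \<beta> (\<beta> x) = x"
proof -
  have *: "\<beta> (inv \<beta> x) = x" "inv \<beta> (\<beta> x) = x" for x
    using assms by (auto simp: push_data_def homeomorphism_def)
  show "\<beta> (inv \<beta> x) = x" "inv \<beta> (\<beta> x) = x" by (fact *)+
  show "bij \<beta>" by (metis * bijI')
qed

lemma push_data_nonneg: "push_data \<beta> v \<Longrightarrow> 0 \<le> v x"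
  by (simp add: push_data_def)

lemma push_data_bound_ex:
  assumes "push_data \<beta> v" shows "\<exists>C\<ge>0. \<forall>x. v x \<le> C"
proof -
  obtain C where "\<And>x. \<bar>v x\<bar> \<le> C"
    using assms unfolding push_data_def bounded_iff real_norm_def by blast
  then have "0 \<le> C" "\<And>x. v x \<le> C" by (meson abs_ge_zero abs_ge_self order_trans)+
  then show ?thesis by blast
qed

text \<open>The bound \<open>C * indicator D\<close> also records where \<open>v\<close> lives, so
  that the estimate sees only the mass of \<open>\<mu>\<close> on \<open>D\<close>;
  \<open>D = UNIV\<close> gives the plain bound.\<close>

lemma emeasure_push_part_le:
  assumes pd: "push_data \<beta> v" and c: "c \<in> quarter_units"
    and C: "0 \<le> C" "\<And>x. v x \<le> C * indicator D x" and D: "D \<in> sets borel" and E: "E \<in> sets borel"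
  shows "emeasure (push_part \<beta> v c \<mu>) E \<le> ennreal C * variation (apply_radon \<mu>) (\<beta> -` E \<inter> D)"
proof -
  note [measurable] = push_data_measurable[OF pd]
  have "emeasure (push_part \<beta> v c \<mu>) E =
      (\<integral>\<^sup>+x. ennreal (v x) * indicator (\<beta> -` E) x \<partial>radon_part c \<mu>)"
    using E D by (simp add: push_part_def emeasure_distr emeasure_density push_data_measurable(3)[OF pd])
  also have "\<dots> \<le> (\<integral>\<^sup>+x. ennreal C * indicator (\<beta> -` E \<inter> D) x \<partial>radon_part c \<mu>)"
  proof (intro nn_integral_mono)
    show "ennreal (v x) * indicator (\<beta> -` E) x \<le> ennreal C * indicator (\<beta> -` E \<inter> D) x" for x
      using C(2)[of x] push_data_nonneg[OF pd, of x] by (auto simp: indicator_def ennreal_leI)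
  qed
  also have "\<dots> = ennreal C * emeasure (radon_part c \<mu>) (\<beta> -` E \<inter> D)"
    using E D by (intro nn_integral_cmult_indicator) (simp add: push_data_measurable(3)[OF pd])
  also have "\<dots> \<le> ennreal C * variation (apply_radon \<mu>) (\<beta> -` E \<inter> D)"
    using E D c by (intro mult_left_mono measure_radon_part(2) norm_quarter_units)
      (auto simp: push_data_measurable(3)[OF pd])
  finally show ?thesis .
qed

lemma finite_measure_push_part:
  assumes pd: "push_data \<beta> v" and c: "c \<in> quarter_units"
  shows "finite_measure (push_part \<beta> v c \<mu>)"
proof -
  obtain C where C: "0 \<le> C" "\<And>x. v x \<le> C" using push_data_bound_ex[OF pd] by auto
  have "emeasure (push_part \<beta> v c \<mu>) UNIV \<le> ennreal C * variation (apply_radon \<mu>) (\<beta> -` UNIV \<inter> UNIV)"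
    by (rule emeasure_push_part_le[OF pd c]) (use C in auto)
  also have "\<dots> < top"
    by (simp add: variation_eq_measure ennreal_mult_less_top)
  finally show ?thesis by (intro finite_measureI) simp
qed

text \<open>Each of the four parts is at most C times the image of |\<mu>| restricted to
  \<open>D\<close>, so the positive measure \<open>N\<close> with factor \<open>4 * C\<close>
  dominates the combination on every Borel set.\<close>

lemma variation_push_sum_le:
  assumes pd: "push_data \<beta> v" 
    and C: "0 \<le> C" "\<And>x. v x \<le> C * indicator D x" and D: "D \<in> sets borel" and E: "E \<in> sets borel"
  shows "variation (\<lambda>E. \<Sum>c\<in>quarter_units. c * of_real (measure (push_part \<beta> v c \<mu>) E)) E
    \<le> ennreal (4 * C) * variation (apply_radon \<mu>) (\<beta> -` E \<inter> D)"
proof -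
  note [measurable] = push_data_measurable[OF pd] D
  define N where "N = scale_measure (ennreal (4 * C))
    (distr (density (variation_measure (apply_radon \<mu>)) (indicator D)) borel \<beta>)"
  have meas: "\<beta> \<in> measurable (variation_measure (apply_radon \<mu>)) borel"
    using measurable_cong_sets[OF sets_variation_measure refl] push_data_measurable(1)[OF pd] by blast
  have N: "emeasure N E = ennreal (4 * C) * variation (apply_radon \<mu>) (\<beta> -` E \<inter> D)"
    if "E \<in> sets borel" for E
  proof -
    have \<beta>E: "\<beta> -` E \<in> sets borel" by (rule push_data_measurable(3)[OF pd that])
    have "emeasure N E = ennreal (4 * C) *
        emeasure (density (variation_measure (apply_radon \<mu>)) (indicator D)) (\<beta> -` E)"
      using that meas by (simp add: N_def emeasure_distr)
    also have "emeasure (density (variation_measure (apply_radon \<mu>)) (indicator D)) (\<beta> -` E) =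
        emeasure (variation_measure (apply_radon \<mu>)) (D \<inter> \<beta> -` E)"
      by (rule emeasure_restricted) (simp_all add: D \<beta>E)
    finally show ?thesis
      by (simp only: emeasure_variation_measure[OF vector_measure_apply] Int_commute)
  qed
  show ?thesis
    unfolding N[OF E, symmetric]
  proof (rule variation_le_emeasure)
    show "sets N = sets borel" by (simp add: N_def)
    fix B :: "'a set" assume B: "B \<in> sets borel"
    have "ennreal (norm (\<Sum>c\<in>quarter_units. c * of_real (measure (push_part \<beta> v c \<mu>) B)))
      \<le> ennreal (\<Sum>c\<in>quarter_units. measure (push_part \<beta> v c \<mu>) B)"
      by (intro ennreal_leI norm_sum[THEN order_trans] sum_mono) (simp add: norm_mult norm_quarter_units)
    also have "\<dots> = (\<Sum>c\<in>quarter_units. emeasure (push_part \<beta> v c \<mu>) B)"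
      using finite_measure.emeasure_eq_measure[OF finite_measure_push_part[OF pd]] by simp
    also have "\<dots> \<le> (\<Sum>c\<in>quarter_units. ennreal C * variation (apply_radon \<mu>) (\<beta> -` B \<inter> D))"
      by (intro sum_mono emeasure_push_part_le[OF pd _ C D B])
    also have "\<dots> = emeasure N B"
      using C(1) by (simp add: N[OF B] card_quarter_units ennreal_mult mult.assoc)
    finally show "ennreal (norm (\<Sum>c\<in>quarter_units. c * of_real (measure (push_part \<beta> v c \<mu>) B))) \<le> emeasure N B" .
  qed
qed

text \<open>If K and U enclose the preimage of E, their images under \<open>\<beta>\<close> enclose
  E, and the preimage of the gap between the images is again U - K.\<close>

lemma radon_push_sum:
  assumes pd: "push_data \<beta> v"
  shows "radon (\<lambda>E. \<Sum>c\<in>quarter_units. c * of_real (measure (push_part \<beta> v c \<mu>) E))" (is "radon ?m")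
proof -
  have vm: "vector_measure ?m"
    by (rule vector_measure_sum_measures) (simp_all add: finite_measure_push_part[OF pd])
  obtain C where C: "0 \<le> C" "\<And>x. v x \<le> C" using push_data_bound_ex[OF pd] by auto
  have le: "variation ?m E \<le> ennreal (4 * C) * variation (apply_radon \<mu>) (\<beta> -` E)" if "E \<in> sets borel" for E
    using variation_push_sum_le[OF pd C(1), of UNIV E] C(2) that by simp
  show ?thesis
    unfolding radon_iff[OF vm]
  proof (intro ballI allI impI)
    fix E :: "'a set" and e :: real assume E: "E \<in> sets borel" and e: "0 < e"
    \<comment> \<open>The added 1 avoids division by zero and makes the final inequality strict,
      since 4C / (4C + 1) < 1.\<close>
    have "0 < e / (4 * C + 1)" using C e by simp
    then obtain K U where KU: "compact K" "open U" "K \<subseteq> \<beta> -` E" "\<beta> -` E \<subseteq> U"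
      "variation (apply_radon \<mu>) (U - K) < ennreal (e / (4 * C + 1))"
      using radon_apply[of \<mu>, unfolded radon_iff[OF vector_measure_apply]] push_data_measurable(3)[OF pd E]
      by meson
    have cont: "continuous_on UNIV \<beta>" "continuous_on UNIV (inv \<beta>)"
      using pd by (auto simp: push_data_def homeomorphism_def)
    have img: "\<beta> ` U = inv \<beta> -` U"
      using push_data_bij[OF pd] by (auto simp: image_iff) (metis)
    have "compact (\<beta> ` K)"
      using compact_continuous_image continuous_on_subset[OF cont(1)] KU(1) by blast
    moreover have U: "open (\<beta> ` U)"
      unfolding img using cont(2) KU(2) by (simp add: open_vimage)
    moreover have "\<beta> ` K \<subseteq> E" "E \<subseteq> \<beta> ` U"
      using KU push_data_bij[OF pd] unfolding img by (auto simp: subset_eq)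
    moreover have "variation ?m (\<beta> ` U - \<beta> ` K) < ennreal e"
    proof -
      have "\<beta> -` (\<beta> ` U - \<beta> ` K) = U - K"
        using push_data_bij(1)[OF pd] by (auto simp: bij_def inj_eq)
      moreover have "\<beta> ` U - \<beta> ` K \<in> sets borel"
        using U \<open>compact (\<beta> ` K)\<close> by (simp add: compact_imp_closed)
      ultimately have "variation ?m (\<beta> ` U - \<beta> ` K) \<le> ennreal (4 * C) * variation (apply_radon \<mu>) (U - K)"
        using le[of "\<beta> ` U - \<beta> ` K"] by simp
      also have "\<dots> \<le> ennreal (4 * C) * ennreal (e / (4 * C + 1))"
        using KU by (intro mult_left_mono) auto
      also have "\<dots> < ennreal e"
        using C e by (subst ennreal_mult[symmetric]) (auto intro!: ennreal_lessI simp: field_simps)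
      finally show ?thesis .
    qed
    ultimately show "\<exists>K U. compact K \<and> open U \<and> K \<subseteq> E \<and> E \<subseteq> U \<and> variation ?m (U - K) < ennreal e"
      by blast
  qed
qed

lemma apply_weighted_push:
  assumes "push_data \<beta> v"
  shows "apply_radon (weighted_push \<beta> v \<mu>) E = (\<Sum>c\<in>quarter_units. c * of_real (measure (push_part \<beta> v c \<mu>) E))"
  unfolding weighted_push_def by (subst Radon_inverse) (simp_all add: radon_push_sum[OF assms])

lemma variation_weighted_push_le:
  assumes "push_data \<beta> v" "0 \<le> C" "\<And>x. v x \<le> C * indicator D x" "D \<in> sets borel" "E \<in> sets borel"
  shows "variation (apply_radon (weighted_push \<beta> v \<mu>)) E \<le> ennreal (4 * C) * variation (apply_radon \<mu>) (\<beta> -` E \<inter> D)"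
  unfolding apply_weighted_push[OF assms(1)] by (rule variation_push_sum_le[OF assms])

lemma bounded_comp_push:
  assumes pd: "push_data \<beta> v" and f: "f \<in> borel_measurable borel" "bounded (range (f :: 'a::t2_space \<Rightarrow> complex))"
  shows "(\<lambda>x. of_real (v x) * f (\<beta> x)) \<in> borel_measurable borel" "bounded (range (\<lambda>x. of_real (v x) * f (\<beta> x)))"
proof -
  note [measurable] = push_data_measurable[OF pd] f(1)
  show "(\<lambda>x. of_real (v x) * f (\<beta> x)) \<in> borel_measurable borel" by measurable
  obtain C where C: "0 \<le> C" "\<And>x. v x \<le> C" using push_data_bound_ex[OF pd] by auto
  obtain b where b: "\<And>x. norm (f x) \<le> b" using f(2) by (auto simp: bounded_iff)
  have "norm (of_real (v x) * f (\<beta> x)) \<le> C * b" for x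
    using C b push_data_nonneg[OF pd] by (simp add: norm_mult mult_mono)
  then show "bounded (range (\<lambda>x. of_real (v x) * f (\<beta> x)))"
    by (auto simp: bounded_iff)
qed

section \<open>Change of variables, composition and linearity of weighted images\<close>

text \<open>The pushed parts represent the image, so by \<open>radon_integral_eqI\<close> they can
  be integrated directly; each one is then transformed by the formulas for image measures and
  densities.\<close>

lemma radon_integral_weighted_push:
  assumes pd: "push_data \<beta> v" and f: "f \<in> borel_measurable borel" "bounded (range f)"
  shows "radon_integral (weighted_push \<beta> v \<mu>) f = radon_integral \<mu> (\<lambda>x. of_real (v x) * f (\<beta> x))"
proof -
  note [measurable] = push_data_measurable[OF pd] f(1)
  have "radon_integral (weighted_push \<beta> v \<mu>) f = (\<Sum>c\<in>quarter_units. c * (\<integral>x. f x \<partial>push_part \<beta> v c \<mu>))"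
    by (rule radon_integral_eqI[OF f]) (simp_all add: finite_measure_push_part[OF pd] apply_weighted_push[OF pd])
  also have "\<dots> = radon_integral \<mu> (\<lambda>x. of_real (v x) * f (\<beta> x))"
    unfolding radon_integral_eq_sum
  proof (intro sum.cong refl arg_cong2[where f="(*)"])
    fix c
    have "(\<integral>x. f x \<partial>push_part \<beta> v c \<mu>) = (\<integral>x. f (\<beta> x) \<partial>density (radon_part c \<mu>) (\<lambda>x. ennreal (v x)))"
      unfolding push_part_def by (rule integral_distr) simp_all
    also have "\<dots> = (\<integral>x. v x *\<^sub>R f (\<beta> x) \<partial>radon_part c \<mu>)"
      by (rule integral_density) (simp_all add: push_data_nonneg[OF pd])
    finally show "(\<integral>x. f x \<partial>push_part \<beta> v c \<mu>) = (\<integral>x. of_real (v x) * f (\<beta> x) \<partial>radon_part c \<mu>)"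
      by (simp add: scaleR_conv_of_real)
  qed
  finally show ?thesis .
qed

text \<open>Taking an indicator as test function reduces identities between weighted images to
  identities between integrals.\<close>

lemma apply_weighted_push_integral:
  assumes pd: "push_data \<beta> v" and E: "E \<in> sets borel"
  shows "apply_radon (weighted_push \<beta> v \<mu>) E = radon_integral \<mu> (\<lambda>x. of_real (v x) * indicator E (\<beta> x))"
proof -
  have "bounded (range (indicator E :: 'a \<Rightarrow> complex))"
    by (rule boundedI[of _ 1]) (auto simp: indicator_def)
  then show ?thesis
    using radon_integral_weighted_push[OF pd, of "indicator E" \<mu>] E
    by (simp add: radon_integral_indicator)
qed

lemma push_data_comp:
  assumes \<beta>: "push_data \<beta> v" and \<gamma>: "push_data \<gamma> u"
  shows "push_data (\<beta> \<circ> \<gamma>) (\<lambda>x. u x * v (\<gamma> x))"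
proof -
  note [measurable] = push_data_measurable[OF \<beta>] push_data_measurable[OF \<gamma>]
  obtain C where C: "0 \<le> C" "\<And>x. v x \<le> C" using push_data_bound_ex[OF \<beta>] by auto
  obtain B where B: "0 \<le> B" "\<And>x. u x \<le> B" using push_data_bound_ex[OF \<gamma>] by auto
  have "homeomorphism UNIV UNIV (\<beta> \<circ> \<gamma>) (inv \<gamma> \<circ> inv \<beta>)"
    using \<beta> \<gamma> unfolding push_data_def by (blast intro: homeomorphism_compose)
  moreover have "inv (\<beta> \<circ> \<gamma>) = inv \<gamma> \<circ> inv \<beta>"
    by (rule o_inv_distrib[OF push_data_bij(1)[OF \<beta>] push_data_bij(1)[OF \<gamma>]])
  moreover have "norm (u x * v (\<gamma> x)) \<le> B * C" for x
    using C B push_data_nonneg[OF \<beta>] push_data_nonneg[OF \<gamma>] by (simp add: abs_mult mult_mono)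
  then have "bounded (range (\<lambda>x. u x * v (\<gamma> x)))"
    unfolding bounded_iff by blast
  moreover have "(\<lambda>x. u x * v (\<gamma> x)) \<in> borel_measurable borel"
    by measurable
  ultimately show ?thesis
    using push_data_nonneg[OF \<beta>] push_data_nonneg[OF \<gamma>] by (simp add: push_data_def)
qed

text \<open>Tested on an indicator, the two pushes cross the integral one after the other. Since
  \<open>\<gamma>\<close> acts first, its density stands at x and that of \<open>\<beta>\<close> at
  \<open>\<gamma> x\<close>.\<close>

lemma weighted_push_comp:
  assumes \<beta>: "push_data \<beta> v" and \<gamma>: "push_data \<gamma> u"
  shows "weighted_push \<beta> v (weighted_push \<gamma> u \<mu>) = weighted_push (\<beta> \<circ> \<gamma>) (\<lambda>x. u x * v (\<gamma> x)) \<mu>"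
proof (rule radon_measure_eqI)
  fix E :: "'a set" assume E: "E \<in> sets borel"
  let ?f = "\<lambda>x. of_real (v x) * indicator E (\<beta> x) :: complex"
  have b: "bounded (range (indicator E :: 'a \<Rightarrow> complex))"
    by (rule boundedI[of _ 1]) (auto simp: indicator_def)
  have f: "?f \<in> borel_measurable borel" "bounded (range ?f)"
    using bounded_comp_push[OF \<beta> _ b] E by simp_all
  show "apply_radon (weighted_push \<beta> v (weighted_push \<gamma> u \<mu>)) E =
      apply_radon (weighted_push (\<beta> \<circ> \<gamma>) (\<lambda>x. u x * v (\<gamma> x)) \<mu>) E"
    by (simp add: apply_weighted_push_integral[OF \<beta> E] radon_integral_weighted_push[OF \<gamma> f]
      apply_weighted_push_integral[OF push_data_comp[OF \<beta> \<gamma>] E] mult.assoc)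
qed

lemma weighted_push_add:
  assumes pd: "push_data \<beta> v"
  shows "weighted_push \<beta> v (\<mu> + \<nu>) = weighted_push \<beta> v \<mu> + weighted_push \<beta> v \<nu>"
proof (rule radon_measure_eqI)
  fix E :: "'a set" assume E: "E \<in> sets borel"
  have b: "bounded (range (indicator E :: 'a \<Rightarrow> complex))"
    by (rule boundedI[of _ 1]) (auto simp: indicator_def)
  show "apply_radon (weighted_push \<beta> v (\<mu> + \<nu>)) E = apply_radon (weighted_push \<beta> v \<mu> + weighted_push \<beta> v \<nu>) E"
    using bounded_comp_push[OF pd _ b] E
    by (simp add: plus_radon_measure.rep_eq apply_weighted_push_integral[OF pd E] radon_integral_add)
qed

lemma weighted_push_scaleR:
  assumes pd: "push_data \<beta> v"
  shows "weighted_push \<beta> v (r *\<^sub>R \<mu>) = r *\<^sub>R weighted_push \<beta> v \<mu>"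
proof (rule radon_measure_eqI)
  fix E :: "'a set" assume E: "E \<in> sets borel"
  have b: "bounded (range (indicator E :: 'a \<Rightarrow> complex))"
    by (rule boundedI[of _ 1]) (auto simp: indicator_def)
  show "apply_radon (weighted_push \<beta> v (r *\<^sub>R \<mu>)) E = apply_radon (r *\<^sub>R weighted_push \<beta> v \<mu>) E"
    using bounded_comp_push[OF pd _ b] E
    by (simp add: scaleR_radon_measure.rep_eq apply_weighted_push_integral[OF pd E] radon_integral_scaleR)
qed

lemma weighted_push_id:
  "weighted_push id (\<lambda>_. 1) \<mu> = \<mu>"
proof (rule radon_measure_eqI)
  fix E :: "'a set" assume E: "E \<in> sets borel"
  have "push_data (id :: 'a \<Rightarrow> 'a) (\<lambda>_. 1)"
    by (simp add: push_data_def homeomorphism_def continuous_on_id id_def inv_id[unfolded id_def])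
  then show "apply_radon (weighted_push id (\<lambda>_. 1) \<mu>) E = apply_radon \<mu> E"
    by (simp add: apply_weighted_push_integral E radon_integral_indicator)
qed

lemma norm_weighted_push_le:
  assumes pd: "push_data \<beta> v" and C: "0 \<le> C" "\<And>x. v x \<le> C * indicator D x" and D: "D \<in> sets borel"
  shows "norm (weighted_push \<beta> v \<mu>) \<le> 4 * C * measure (variation_measure (apply_radon \<mu>)) D"
  using variation_weighted_push_le[OF pd C D, of UNIV \<mu>] C(1)
  by (simp add: norm_radon_measure_def variation_eq_measure ennreal_mult[symmetric])

lemma bounded_linear_weighted_push:
  assumes pd: "push_data \<beta> v" shows "bounded_linear (weighted_push \<beta> v)"
proof -
  obtain C where C: "0 \<le> C" "\<And>x. v x \<le> C" using push_data_bound_ex[OF pd] by auto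
  show ?thesis
  proof (rule bounded_linear_intro[OF weighted_push_add[OF pd] weighted_push_scaleR[OF pd]])
    show "norm (weighted_push \<beta> v \<mu>) \<le> norm \<mu> * (4 * C)" for \<mu>
      using norm_weighted_push_le[OF pd C(1), of UNIV \<mu>] C(2)
      by (simp add: norm_radon_measure_def variation_eq_measure mult_ac)
  qed
qed

section \<open>Uniqueness of the representing measure\<close>

lemma apply_radon_diff: "apply_radon (\<mu> - \<nu>) E = apply_radon \<mu> E - apply_radon \<nu> E"
  unfolding minus_radon_measure_def uminus_radon_measure_def plus_radon_measure.rep_eq
    scaleR_radon_measure.rep_eq by simp

lemma radon_integral_diff:
  assumes "f \<in> borel_measurable borel" "bounded (range f)"
  shows "radon_integral (\<mu> - \<nu>) f = radon_integral \<mu> f - radon_integral \<nu> f"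
  unfolding minus_radon_measure_def uminus_radon_measure_def radon_integral_add[OF assms]
    radon_integral_scaleR[OF assms] by simp

lemma C0_measurable: "f \<in> C0 \<Longrightarrow> f \<in> borel_measurable borel"
  by (auto simp: C0_def intro: borel_measurable_continuous_onI)

lemma C0_bounded:
  assumes "f \<in> C0" shows "bounded (range f)"
proof -
  have f: "continuous_on UNIV f" and "compact {x. 1 \<le> norm (f x)}"
    using assms by (auto simp: C0_def)
  then have "bounded (f ` {x. 1 \<le> norm (f x)})"
    by (intro compact_imp_bounded compact_continuous_image) (auto intro: continuous_on_subset)
  then obtain b where b: "\<And>x. 1 \<le> norm (f x) \<Longrightarrow> norm (f x) \<le> b"
    by (auto simp: bounded_iff)
  have "norm (f x) \<le> max 1 b" for x
    using b[of x] by linarith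
  then show ?thesis by (auto simp: bounded_iff)
qed

text \<open>A locally compact Hausdorff space is completely regular. Requiring zero outside
  \<open>U \<inter> V\<close>, where V lies in the compact set L, makes the level sets closed
  subsets of L and puts the function into \<open>C0\<close>.\<close>

lemma locally_compact_Urysohn_C0:
  fixes K U :: "'a::t2_space set"
  assumes lc: "locally_compact_space (euclidean :: 'a topology)"
    and K: "compact K" and U: "open U" "K \<subseteq> U"
  obtains f :: "'a \<Rightarrow> real" where "(\<lambda>x. complex_of_real (f x)) \<in> C0"
    "\<And>x. 0 \<le> f x" "\<And>x. f x \<le> 1" "\<And>x. x \<in> K \<Longrightarrow> f x = 1" "\<And>x. x \<notin> U \<Longrightarrow> f x = 0"
proof -
  have H: "Hausdorff_space (euclidean :: 'a topology)"
    unfolding Hausdorff_space_def disjnt_def open_openin[symmetric] by simp (metis hausdorff)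
  obtain V L where V: "open V" "compact L" "K \<subseteq> V" "V \<subseteq> L"
    using locally_compact_space_compact_closed_compact[of "euclidean :: 'a topology"] H lc K by auto
  have reg: "completely_regular_space (euclidean :: 'a topology)"
    by (meson H lc locally_compact_Hausdorff_or_regular locally_compact_regular_imp_completely_regular_space
        locally_compact_Hausdorff_imp_regular_space)
  obtain f :: "'a \<Rightarrow> real" where f: "continuous_map euclidean (top_of_set {0..1}) f"
      "f ` (- (U \<inter> V)) \<subseteq> {0}" "f ` K \<subseteq> {1}"
    using Urysohn_completely_regular_compact_closed[of 0 1 "euclidean :: 'a topology" K "- (U \<inter> V)"]
      reg K U V by (auto simp: disjnt_def open_Int)
  have cont: "continuous_on UNIV f" and range: "f x \<in> {0..1}" for x
    using f(1) by (auto simp: continuous_map_in_subtopology)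
  show thesis
  proof (rule that)
    have "compact {x. e \<le> norm (complex_of_real (f x))}" if "e > 0" for e
    proof -
      have "closed {x. e \<le> \<bar>f x\<bar>}"
        using cont by (intro closed_Collect_le continuous_intros)
      moreover have "{x. e \<le> \<bar>f x\<bar>} \<subseteq> L"
        using f(2) V(4) that by (force simp: image_subset_iff)
      ultimately show ?thesis
        using V(2) by (metis (no_types, lifting) compact_Int_closed inf.absorb2 norm_of_real Collect_cong)
    qed
    then show "(\<lambda>x. complex_of_real (f x)) \<in> C0"
      using cont by (auto simp: C0_def intro!: continuous_intros)
    show "f x = 1" if "x \<in> K" for x using f(3) that by auto
    show "f x = 0" if "x \<notin> U" for x using f(2) that by auto
  qed (use range in auto)
qed

text \<open>Urysohn functions approximate the indicator of a compact set, which gives zero on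
  compact sets; inner regularity extends this to all Borel sets.\<close>

lemma radon_measure_eq_0I:
  fixes \<nu> :: "'a::t2_space radon_measure"
  assumes lc: "locally_compact_space (euclidean :: 'a topology)"
    and zero: "\<And>f. f \<in> C0 \<Longrightarrow> radon_integral \<nu> f = 0"
  shows "\<nu> = 0"
proof -
  have approx: "\<exists>K U. compact K \<and> open U \<and> K \<subseteq> E \<and> E \<subseteq> U \<and> variation (apply_radon \<nu>) (U - K) < ennreal e"
    if "E \<in> sets borel" "e > 0" for E e
    using radon_apply[of \<nu>, unfolded radon_iff[OF vector_measure_apply]] that by blast
  have compact_zero: "apply_radon \<nu> K = 0" if K: "compact K" for K
  proof -
    have borel: "K \<in> sets borel" using K by (simp add: compact_imp_closed)
    have "norm (apply_radon \<nu> K) \<le> 0 + e" if e: "e > 0" for e :: real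
    proof -
      \<comment> \<open>Since K' lies inside K, the gap U - K is no heavier than U - K'. The quarter
        of e leaves room for four parts.\<close>
      obtain K' U where U: "open U" "K' \<subseteq> K" "K \<subseteq> U" "compact K'" "variation (apply_radon \<nu>) (U - K') < ennreal (e/4)"
        using approx[OF borel, of "e / 4"] e by auto
      have UK: "U - K \<in> sets borel" using U(1) borel by simp
      have "variation (apply_radon \<nu>) (U - K) \<le> variation (apply_radon \<nu>) (U - K')"
        using U UK by (intro variation_mono[OF vector_measure_apply]) (auto simp: compact_imp_closed)
      with U(5) have small: "variation (apply_radon \<nu>) (U - K) < ennreal (e/4)" by simp
      obtain f where C0: "(\<lambda>x. complex_of_real (f x)) \<in> C0"
        and f: "\<And>x. 0 \<le> f x" "\<And>x. f x \<le> 1" "\<And>x. x \<in> K \<Longrightarrow> f x = 1" "\<And>x. x \<notin> U \<Longrightarrow> f x = 0"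
        using locally_compact_Urysohn_C0[OF lc K U(1,3)] by blast
      have meas: "f \<in> borel_measurable borel"
        using C0_measurable[OF C0] by (simp add: borel_measurable_complex_iff)
      \<comment> \<open>The function f lies between the indicators of K and U, so on each positive
        part the error is at most the mass of U - K.\<close>
      have part: "norm (complex_of_real (measure (radon_part c \<nu>) K) - (\<integral>x. complex_of_real (f x) \<partial>radon_part c \<nu>))
          \<le> measure (radon_part c \<nu>) (U - K)" if c: "c \<in> quarter_units" for c
      proof -
        interpret finite_measure "radon_part c \<nu>" by (rule finite_measure_radon_part[OF c])
        have int: "integrable (radon_part c \<nu>) f"
          using f meas by (intro integrable_const_bound[of _ 1]) auto
        have ind: "integrable (radon_part c \<nu>) (indicator K :: 'a \<Rightarrow> real)"
            "integrable (radon_part c \<nu>) (indicator (U - K) :: 'a \<Rightarrow> real)"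
          using borel UK by (auto simp: less_top[symmetric])
        have "(\<integral>x. f x \<partial>radon_part c \<nu>) \<ge> (\<integral>x. indicator K x \<partial>radon_part c \<nu>)"
          using f by (intro integral_mono ind int) (auto simp: indicator_def)
        moreover have "(\<integral>x. f x \<partial>radon_part c \<nu>) \<le> (\<integral>x. indicator K x + indicator (U - K) x \<partial>radon_part c \<nu>)"
          using f by (intro integral_mono Bochner_Integration.integrable_add ind int) (auto simp: indicator_def)
        ultimately have "\<bar>measure (radon_part c \<nu>) K - (\<integral>x. f x \<partial>radon_part c \<nu>)\<bar> \<le> measure (radon_part c \<nu>) (U - K)"
          using ind by simp
        then show ?thesis
          by (simp add: norm_of_real flip: of_real_diff)
      qed
      have "apply_radon \<nu> K = apply_radon \<nu> K - radon_integral \<nu> (\<lambda>x. complex_of_real (f x))"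
        by (simp add: zero[OF C0])
      also have "\<dots> = (\<Sum>c\<in>quarter_units. c * (of_real (measure (radon_part c \<nu>) K) - (\<integral>x. complex_of_real (f x) \<partial>radon_part c \<nu>)))"
        unfolding radon_integral_eq_sum apply_radon_eq_sum by (simp add: right_diff_distrib sum_subtractf)
      also have "norm \<dots> \<le> (\<Sum>c\<in>quarter_units. e / 4)"
      proof (intro norm_sum[THEN order_trans] sum_mono)
        fix c assume c: "c \<in> quarter_units"
        have "ennreal (measure (radon_part c \<nu>) (U - K)) < ennreal (e / 4)"
          using measure_radon_part(2)[OF norm_quarter_units[OF c] UK, of \<nu>] small
            finite_measure.emeasure_eq_measure[OF finite_measure_radon_part[OF c]]
          by (metis order_le_less_trans)
        then have "measure (radon_part c \<nu>) (U - K) \<le> e / 4"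
          using e by (simp add: ennreal_less_iff)
        then show "norm (c * (of_real (measure (radon_part c \<nu>) K) - (\<integral>x. complex_of_real (f x) \<partial>radon_part c \<nu>))) \<le> e / 4"
          using part[OF c] by (simp add: norm_mult norm_quarter_units[OF c])
      qed
      finally show ?thesis by (simp add: card_quarter_units)
    qed
    then have "norm (apply_radon \<nu> K) \<le> 0" by (rule field_le_epsilon)
    then show ?thesis by simp
  qed
  show ?thesis
  proof (rule radon_measure_eqI)
    fix E :: "'a set" assume E: "E \<in> sets borel"
    have "norm (apply_radon \<nu> E) \<le> 0 + e" if e: "e > 0" for e :: real
    proof -
      obtain K U where KU: "compact K" "open U" "K \<subseteq> E" "E \<subseteq> U" "variation (apply_radon \<nu>) (U - K) < ennreal e"
        using approx[OF E e] by blast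
      have K: "K \<in> sets borel" using KU by (simp add: compact_imp_closed)
      \<comment> \<open>The compact part carries value zero, so only the small remainder E - K
        counts.\<close>
      have "apply_radon \<nu> E = apply_radon \<nu> (E - K)"
        using vector_measure_Diff[OF vector_measure_apply E K KU(3), of \<nu>] compact_zero[OF KU(1)] by simp
      then have "ennreal (norm (apply_radon \<nu> E)) \<le> variation (apply_radon \<nu>) (E - K)"
        using norm_le_variation[of "E - K" "apply_radon \<nu>"] E K by simp
      also have "\<dots> \<le> variation (apply_radon \<nu>) (U - K)"
        using KU E K by (intro variation_mono[OF vector_measure_apply]) auto
      finally have "ennreal (norm (apply_radon \<nu> E)) < ennreal e" using KU(5) by simp
      then show ?thesis using e by (simp add: ennreal_less_iff)
    qed
    then have "norm (apply_radon \<nu> E) \<le> 0" by (rule field_le_epsilon)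
    then show "apply_radon \<nu> E = apply_radon 0 E" by (simp add: zero_radon_measure.rep_eq)
  qed
qed

section \<open>The adjoints as weighted images\<close>

text \<open>Two representing measures differ by one that annihilates \<open>C0\<close> and hence
  vanishes; this is the uniqueness that \<open>THE\<close> demands.\<close>

lemma radon_adjoint_eqI:
  fixes \<nu> :: "'a::t2_space radon_measure"
  assumes lc: "locally_compact_space (euclidean :: 'a topology)"
    and eq: "\<And>f. f \<in> C0 \<Longrightarrow> radon_integral \<nu> f = radon_integral \<mu> (A f)"
  shows "radon_adjoint A \<mu> = \<nu>"
  unfolding radon_adjoint_def
proof (rule the_equality)
  show "\<forall>f\<in>C0. radon_integral \<nu> f = radon_integral \<mu> (A f)" using eq by blast
  fix \<rho> assume \<rho>: "\<forall>f\<in>C0. radon_integral \<rho> f = radon_integral \<mu> (A f)"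
  have "\<rho> - \<nu> = 0"
  proof (rule radon_measure_eq_0I[OF lc])
    fix f :: "'a \<Rightarrow> complex" assume f: "f \<in> C0"
    have "radon_integral \<rho> f = radon_integral \<nu> f" using \<rho> eq f by simp
    then show "radon_integral (\<rho> - \<nu>) f = 0"
      by (simp add: radon_integral_diff C0_measurable[OF f] C0_bounded[OF f])
  qed
  then show "\<rho> = \<nu>" by simp
qed

text \<open>The change of variables formula exhibits the representing measure. It covers
  \<open>wcomp\<close> and, with the reciprocal weight, \<open>wcomp_inv\<close>.\<close>

lemma radon_adjoint_eq_weighted_push:
  fixes \<beta> :: "'a::t2_space \<Rightarrow> 'a"
  assumes lc: "locally_compact_space (euclidean :: 'a topology)" and pd: "push_data \<beta> v"
    and A: "\<And>f x. A f x = of_real (v x) * f (\<beta> x)"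
  shows "radon_adjoint A = weighted_push \<beta> v"
proof
  fix \<mu> :: "'a radon_measure"
  have "A f = (\<lambda>x. of_real (v x) * f (\<beta> x))" for f using A by blast
  then show "radon_adjoint A \<mu> = weighted_push \<beta> v \<mu>"
    by (intro radon_adjoint_eqI[OF lc])
      (simp add: radon_integral_weighted_push[OF pd] C0_measurable C0_bounded)
qed

section \<open>Completeness\<close>

text \<open>Completeness in the form used for bilateral series. The sum is formed setwise;
  \<open>tail\<close> bounds the variation of a remainder by the remaining norms, which yields both
  regularity of the sum and convergence in norm.\<close>

lemma summable_radon_measure:
  fixes f :: "nat \<Rightarrow> 'a::t2_space radon_measure"
  assumes sum: "summable (\<lambda>n. norm (f n))"
  shows "summable f"
proof -
  define m where "m E = (\<Sum>n. apply_radon (f n) E)" for E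
  let ?V = "\<lambda>n. variation_measure (apply_radon (f n))"
  have fin: "finite_measure (?V n)" for n
    by (rule finite_measure_variation[OF vector_measure_apply])
  have norm_f: "norm (f n) = measure (?V n) UNIV" for n
    by (simp add: norm_radon_measure_def variation_eq_measure)
  have norm_apply: "norm (apply_radon (f n) E) \<le> measure (?V n) E" for n E
  proof (cases "E \<in> sets borel")
    case True
    then show ?thesis using norm_le_variation[OF True, of "apply_radon (f n)"]
      by (simp add: variation_eq_measure)
  next
    case False
    then show ?thesis by (simp add: vector_measure_nonborel[OF vector_measure_apply])
  qed
  have V_le: "measure (?V n) E \<le> norm (f n)" for n E
    unfolding norm_f using finite_measure.bounded_measure[OF fin[of n], of E] by simp
  have sum_V: "summable (\<lambda>n. measure (?V n) E)" for E
    by (rule summable_comparison_test'[OF sum]) (simp add: V_le)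
  have sum_f: "summable (\<lambda>n. apply_radon (f n) E)" for E
    by (rule summable_comparison_test'[OF sum_V[of E]]) (rule norm_apply)
  \<comment> \<open>A partition is finite, so its sum can be exchanged with the series; each
    \<open>f n\<close> then contributes at most its norm.\<close>
  have tail: "variation (\<lambda>E. \<Sum>n. apply_radon (f (n + N)) E) E \<le> ennreal (\<Sum>n. norm (f (n + N)))" for N E
    unfolding variation_def
  proof (rule SUP_least)
    fix P assume P: "P \<in> borel_partitions E"
    have summ: "summable (\<lambda>n. norm (apply_radon (f (n + N)) B))" for B
      by (rule summable_comparison_test'[OF summable_ignore_initial_segment[OF sum_V[of B], of N]])
        (simp add: norm_apply)
    have "(\<Sum>B\<in>P. norm (\<Sum>n. apply_radon (f (n + N)) B)) \<le> (\<Sum>B\<in>P. \<Sum>n. norm (apply_radon (f (n + N)) B))"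
      by (intro sum_mono summable_norm summ)
    also have "\<dots> = (\<Sum>n. \<Sum>B\<in>P. norm (apply_radon (f (n + N)) B))"
      by (intro suminf_sum[symmetric] summ)
    also have "\<dots> \<le> (\<Sum>n. norm (f (n + N)))"
    proof (rule suminf_le)
      fix n
      have "ennreal (\<Sum>B\<in>P. norm (apply_radon (f (n + N)) B)) \<le> variation (apply_radon (f (n + N))) E"
        unfolding variation_def using P by (intro SUP_upper2[OF P]) simp
      also have "\<dots> \<le> ennreal (norm (f (n + N)))"
        by (simp add: variation_eq_measure V_le)
      finally show "(\<Sum>B\<in>P. norm (apply_radon (f (n + N)) B)) \<le> norm (f (n + N))" by simp
    qed (auto intro: summable_sum summ summable_ignore_initial_segment sum)
    finally show "(\<Sum>B\<in>P. ennreal (norm (\<Sum>n. apply_radon (f (n + N)) B))) \<le> ennreal (\<Sum>n. norm (f (n + N)))"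
      by (simp add: ennreal_leI)
  qed
  have tail_0: "(\<lambda>N. \<Sum>n. norm (f (n + N))) \<longlonglongrightarrow> 0"
    using suminf_exist_split2[OF sum] .
  have apply_sum: "apply_radon (\<Sum>n<N. f n) E = (\<Sum>n<N. apply_radon (f n) E)" for N E
    by (induction N) (simp_all add: zero_radon_measure.rep_eq plus_radon_measure.rep_eq)
  have split: "m E = apply_radon (\<Sum>n<N. f n) E + (\<Sum>n. apply_radon (f (n + N)) E)" for N E
    unfolding m_def apply_sum using suminf_split_initial_segment[OF sum_f[of E], of N] by simp
  have vm: "vector_measure m"
    unfolding vector_measure_def
  proof (intro conjI allI impI)
    fix A :: "nat \<Rightarrow> 'a set" assume A: "range A \<subseteq> sets borel" "disjoint_family A"
    have V_sums: "(\<lambda>i. measure (?V n) (A i)) sums measure (?V n) (\<Union>i. A i)" for n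
      using A by (intro finite_measure.finite_measure_UNION[OF fin]) auto
    show "(\<lambda>i. m (A i)) sums m (\<Union>i. A i)"
      unfolding sums_def
    proof -
      have part: "norm (\<Sum>i<M. apply_radon (f n) (A i)) \<le> norm (f n)" for n M
      proof -
        have "norm (\<Sum>i<M. apply_radon (f n) (A i)) \<le> (\<Sum>i<M. measure (?V n) (A i))"
          by (intro norm_sum[THEN order_trans] sum_mono norm_apply)
        also have "\<dots> \<le> (\<Sum>i. measure (?V n) (A i))"
          using V_sums[of n] by (intro sum_le_suminf) (auto simp: sums_iff)
        also have "\<dots> \<le> norm (f n)"
          using V_sums[of n] V_le by (simp add: sums_iff)
        finally show ?thesis .
      qed
      \<comment> \<open>Tannery's theorem exchanges the limit in M with the sum over n: by
        \<open>part\<close> the norms of \<open>f n\<close> dominate uniformly in M.\<close>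
      have "(\<lambda>M. \<Sum>n. \<Sum>i<M. apply_radon (f n) (A i)) \<longlonglongrightarrow> (\<Sum>n. apply_radon (f n) (\<Union>i. A i))"
        using always_eventually[of "\<lambda>(n, M). norm (\<Sum>i<M. apply_radon (f n) (A i)) \<le> norm (f n)"
            "sequentially \<times>\<^sub>F sequentially"]
          tannerys_theorem[of "\<lambda>n M. \<Sum>i<M. apply_radon (f n) (A i)"
            "\<lambda>n. apply_radon (f n) (\<Union>i. A i)" sequentially "\<lambda>n. norm (f n)"]
          vector_measureD[OF vector_measure_apply A] part sum
        by (simp add: sums_def split_beta)
      then show "(\<lambda>M. \<Sum>i<M. m (A i)) \<longlonglongrightarrow> m (\<Union>i. A i)"
        unfolding m_def by (subst suminf_sum[symmetric]) (rule sum_f)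
    qed
  next
    fix E :: "'a set" assume "E \<notin> sets borel"
    then show "m E = 0"
      by (simp add: m_def vector_measure_nonborel[OF vector_measure_apply])
  qed
  have rm: "radon m"
    unfolding radon_iff[OF vm]
  proof (intro ballI allI impI)
    fix E :: "'a set" and e :: real assume E: "E \<in> sets borel" and e: "0 < e"
    \<comment> \<open>Half of e goes to the remainder after N terms, the other half to the
      regularity of the partial sum, which is already Radon.\<close>
    obtain N where N: "(\<Sum>n. norm (f (n + N))) < e / 2"
      using order_tendstoD(2)[OF tail_0, of "e / 2"] e by (auto simp: eventually_sequentially)
    have "0 < e / 2" using e by simp
    then obtain K U where KU: "compact K" "open U" "K \<subseteq> E" "E \<subseteq> U"
        "variation (apply_radon (\<Sum>n<N. f n)) (U - K) < ennreal (e / 2)"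
      using radon_apply[of "\<Sum>n<N. f n", unfolded radon_iff[OF vector_measure_apply]] E by meson
    have "variation m (U - K) \<le> variation (apply_radon (\<Sum>n<N. f n)) (U - K) +
        variation (\<lambda>E. \<Sum>n. apply_radon (f (n + N)) E) (U - K)"
      unfolding split[of _ N, abs_def] by (rule variation_add_le)
    also have "\<dots> < ennreal (e / 2) + ennreal (e / 2)"
    proof (rule add_strict_mono[OF KU(5)])
      have "ennreal (\<Sum>n. norm (f (n + N))) < ennreal (e / 2)"
        using N e by (intro ennreal_lessI) auto
      then show "variation (\<lambda>E. \<Sum>n. apply_radon (f (n + N)) E) (U - K) < ennreal (e / 2)"
        using tail le_less_trans by blast
    qed
    also have "\<dots> = ennreal e" using e by (simp flip: ennreal_plus)
    finally show "\<exists>K U. compact K \<and> open U \<and> K \<subseteq> E \<and> E \<subseteq> U \<and> variation m (U - K) < ennreal e"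
      using KU by blast
  qed
  have "(\<lambda>N. \<Sum>n<N. f n) \<longlonglongrightarrow> Radon m"
  proof (rule tendsto_norm_zero_cancel[THEN LIM_zero_cancel])
    show "(\<lambda>N. norm ((\<Sum>n<N. f n) - Radon m)) \<longlonglongrightarrow> 0"
    proof (rule tendsto_sandwich[OF _ _ tendsto_const tail_0])
      have "norm ((\<Sum>n<N. f n) - Radon m) \<le> (\<Sum>n. norm (f (n + N)))" for N
      proof -
        have "apply_radon (Radon m - (\<Sum>n<N. f n)) = (\<lambda>E. \<Sum>n. apply_radon (f (n + N)) E)"
          using split[of _ N] by (simp add: fun_eq_iff apply_radon_diff Radon_inverse rm)
        then have "norm (Radon m - (\<Sum>n<N. f n)) = enn2real (variation (\<lambda>E. \<Sum>n. apply_radon (f (n + N)) E) UNIV)"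
          by (simp add: norm_radon_measure_def)
        also have "\<dots> \<le> (\<Sum>n. norm (f (n + N)))"
          using tail by (intro enn2real_leI suminf_nonneg summable_ignore_initial_segment sum) auto
        finally show ?thesis by (simp add: norm_minus_commute)
      qed
      then show "\<forall>\<^sub>F N in sequentially. norm ((\<Sum>n<N. f n) - Radon m) \<le> (\<Sum>n. norm (f (n + N)))" by simp
    qed simp
  qed
  then show ?thesis unfolding summable_def sums_def by blast
qed

section \<open>A criterion for chaos\<close>

lemma funpow_cancel:
  fixes f g :: "'b \<Rightarrow> 'b"
  assumes "\<And>x. f (g x) = x" shows "(f ^^ n) ((g ^^ n) x) = x"
proof (induction n)
  case (Suc n)
  have "(f ^^ Suc n) ((g ^^ Suc n) x) = (f ^^ n) (f (g ((g ^^ n) x)))"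
    by (simp only: funpow_Suc_right[of n f] funpow.simps(2)[of n g] o_apply)
  then show ?case by (simp only: assms Suc)
qed simp

lemma bounded_linear_funpow:
  fixes T :: "'x::real_normed_vector \<Rightarrow> 'x"
  assumes "bounded_linear T" shows "bounded_linear (T ^^ n)"
proof (induction n)
  case 0 then show ?case by (simp add: id_def)
next
  case (Suc n) then show ?case using bounded_linear_compose[OF assms Suc] by (simp add: o_def)
qed

text \<open>In a general normed space, convergence of \<open>f\<close> does not follow from that of
  the norms; it is therefore a separate premise.\<close>

lemma norm_suminf_le_suminf_norm:
  fixes f :: "nat \<Rightarrow> 'x::real_normed_vector"
  assumes "summable f" "summable (\<lambda>n. norm (f n))"
  shows "norm (\<Sum>n. f n) \<le> (\<Sum>n. norm (f n))"
proof (rule tendsto_le[OF sequentially_bot])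
  show "(\<lambda>N. \<Sum>n<N. norm (f n)) \<longlonglongrightarrow> (\<Sum>n. norm (f n))"
    using assms(2) by (rule summable_LIMSEQ)
  show "(\<lambda>N. norm (\<Sum>n<N. f n)) \<longlonglongrightarrow> norm (\<Sum>n. f n)"
    using assms(1) by (intro tendsto_norm summable_LIMSEQ)
qed (simp add: norm_sum)

lemma chaoticI:
  assumes "\<And>x y e. 0 < e \<Longrightarrow> \<exists>n\<ge>1. \<exists>z. norm (z - x) < e \<and> norm (F n z - y) < e"
    and "\<And>x e. 0 < e \<Longrightarrow> \<exists>z\<in>periodic_elements F. norm (z - x) < e"
  shows "chaotic F"
  unfolding chaotic_def topologically_transitive_def
proof (intro conjI allI impI)
  fix U V :: "'a set" assume UV: "open U \<and> U \<noteq> {} \<and> open V \<and> V \<noteq> {}"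
  then obtain x y where "x \<in> U" "y \<in> V" by blast
  with UV obtain d e where d: "0 < d" "ball x d \<subseteq> U" and e: "0 < e" "ball y e \<subseteq> V"
    by (meson open_contains_ball)
  obtain n z where "n \<ge> 1" and z: "norm (z - x) < min d e" "norm (F n z - y) < min d e"
    using assms(1)[of "min d e" x y] d e by auto
  have "z \<in> U" "F n z \<in> V"
    using d e z by (auto simp: subset_eq dist_norm norm_minus_commute)
  then show "\<exists>n\<ge>1. F n ` U \<inter> V \<noteq> {}" using \<open>n \<ge> 1\<close> by blast
next
  show "closure (periodic_elements F) = UNIV"
    using assms(2) by (auto simp: closure_approachable dist_norm)
qed

text \<open>The bilateral series \<open>\<Sum>l\<in>\<int>. T\<^sup>l\<^sup>n x'\<close> is fixed by \<open>T\<^sup>n\<close> and close to \<open>x\<close>; the points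
  \<open>x' + S\<^sup>n y'\<close> and \<open>x' + 2 S\<^sup>n y'\<close> witness transitivity of the powers and of the cosine means.
  In the latter case the remainder \<open>S\<^sup>2\<^sup>n y'\<close> is the term \<open>l = 1\<close> of the hypothesis.\<close>

lemma chaotic_powers_and_cosines:
  fixes T S :: "'x::real_normed_vector \<Rightarrow> 'x"
  assumes T: "bounded_linear T" and S: "bounded_linear S"
    and TS: "\<And>x. T (S x) = x" and ST: "\<And>x. S (T x) = x"
    and complete: "\<And>f :: nat \<Rightarrow> 'x. summable (\<lambda>n. norm (f n)) \<Longrightarrow> summable f"
    and small: "\<And>x y e. 0 < e \<Longrightarrow> \<exists>n\<ge>1. \<exists>x' y'. norm (x' - x) < e \<and> norm (y' - y) < e \<and>
      (\<forall>z\<in>{x', y'}. \<forall>R\<in>{T, S}. summable (\<lambda>l. norm ((R ^^ (Suc l * n)) z)) \<and>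
        (\<Sum>l. norm ((R ^^ (Suc l * n)) z)) < e)"
  shows "chaotic (\<lambda>n. T ^^ n)" and "chaotic (\<lambda>n x. (1 / 2) *\<^sub>R ((T ^^ n) x + (S ^^ n) x))"
proof -
  note TSn = funpow_cancel[of T S, OF TS] and STn = funpow_cancel[of S T, OF ST]
  have lin: "linear (T ^^ n)" "linear (S ^^ n)" for n
    using bounded_linear_funpow[OF T] bounded_linear_funpow[OF S] bounded_linear.linear by blast+
  have orbit: "norm ((R ^^ (Suc l * n)) z) < e"
    if "summable (\<lambda>l. norm ((R ^^ (Suc l * n)) z))" "(\<Sum>l. norm ((R ^^ (Suc l * n)) z)) < e"
    for R :: "'x \<Rightarrow> 'x" and l n z e
    using sum_le_suminf[OF that(1), of "{l}"] that(2) by simp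
  have trans: "\<exists>n\<ge>1. \<exists>x' y'. norm (x' - x) < e \<and> norm (y' - y) < e \<and>
      norm ((T ^^ n) x') < e \<and> norm ((S ^^ n) x') < e \<and> norm ((S ^^ n) y') < e \<and> norm ((S ^^ (n + n)) y') < e"
    if "0 < e" for x y e
  proof -
    obtain n x' y' where n: "n \<ge> 1" and xy: "norm (x' - x) < e" "norm (y' - y) < e"
      and sm: "\<And>z R. z \<in> {x', y'} \<Longrightarrow> R \<in> {T, S} \<Longrightarrow> summable (\<lambda>l. norm ((R ^^ (Suc l * n)) z)) \<and>
        (\<Sum>l. norm ((R ^^ (Suc l * n)) z)) < e"
      using small[OF \<open>0 < e\<close>, of x y] by meson
    have "norm ((R ^^ (Suc l * n)) z) < e" if "z \<in> {x', y'}" "R \<in> {T, S}" for z R l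
      using orbit sm[OF that] by blast
    \<comment> \<open>The exponents \<open>Suc l * n\<close> start at n: l = 0 gives the n-th powers
      and l = 1 the power 2n needed for the cosine means.\<close>
    from this[of _ _ 0] this[of y' S 1] show ?thesis
      using n xy by (intro exI[of _ n] conjI exI[of _ x'] exI[of _ y']) (auto simp: mult_2)
  qed
  have periodic: "\<exists>z n. n \<ge> 1 \<and> norm (z - x) < e \<and> (\<forall>k. (T ^^ (k * n)) z = z \<and> (S ^^ (k * n)) z = z)"
    if e: "0 < e" for x e
  proof -
    \<comment> \<open>One third each for the distance from x' to x, the forward sum and the backward
      sum.\<close>
    have "0 < e / 3" using e by simp
    from small[OF this, of x x] obtain n x' where n: "n \<ge> 1" and x': "norm (x' - x) < e / 3"
      and sm: "\<And>R. R \<in> {T, S} \<Longrightarrow> summable (\<lambda>l. norm ((R ^^ (Suc l * n)) x')) \<and>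
        (\<Sum>l. norm ((R ^^ (Suc l * n)) x')) < e / 3"
      by (metis insertI1)
    \<comment> \<open>Here f and g are the forward and backward halves of the bilateral series; x'
      is its term of index 0.\<close>
    define f where "f l = (T ^^ (Suc l * n)) x'" for l
    define g where "g l = (S ^^ (Suc l * n)) x'" for l
    have f: "summable (\<lambda>l. norm (f l))" "(\<Sum>l. norm (f l)) < e / 3"
      and g: "summable (\<lambda>l. norm (g l))" "(\<Sum>l. norm (g l)) < e / 3"
      using sm[of T] sm[of S] by (simp_all add: f_def g_def)
    note fs = complete[OF f(1)] and gs = complete[OF g(1)]
    define z where "z = x' + suminf f + suminf g"
    have "norm (suminf f) < e / 3" "norm (suminf g) < e / 3"
      using norm_suminf_le_suminf_norm[OF fs f(1)] norm_suminf_le_suminf_norm[OF gs g(1)] f(2) g(2) by linarith+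
    moreover have "norm (z - x) = norm ((x' - x) + suminf f + suminf g)"
      by (simp add: z_def algebra_simps)
    ultimately have "norm (z - x) < e"
      using x' norm_triangle_ineq[of "(x' - x) + suminf f" "suminf g"] norm_triangle_ineq[of "x' - x" "suminf f"]
      by linarith
    moreover have Tz: "(T ^^ n) z = z"
    proof -
      \<comment> \<open>Applying T^n shifts the bilateral series by one place: x' becomes f 0, the
        vector g 0 becomes x', and every other term moves to its neighbour. The sum is therefore
        unchanged.\<close>
      have Tf: "(T ^^ n) (f l) = f (Suc l)" for l
        by (simp add: f_def funpow_add)
      have Tg: "(T ^^ n) (g (Suc l)) = g l" for l
        using TSn[of n "(S ^^ (Suc l * n)) x'"] by (simp add: g_def funpow_add)
      have Tx: "(T ^^ n) x' = f 0" by (simp add: f_def)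
      have Tg0: "(T ^^ n) (g 0) = x'" using TSn by (simp add: g_def)
      note B = bounded_linear_funpow[OF T, of n]
      have "(T ^^ n) z = f 0 + (\<Sum>l. (T ^^ n) (f l)) + (\<Sum>l. (T ^^ n) (g l))"
        using fs gs by (simp add: z_def linear_add[OF lin(1)] Tx bounded_linear.suminf[OF B])
      also have "(\<Sum>l. (T ^^ n) (g l)) = x' + suminf g"
        using suminf_split_head[OF bounded_linear.summable[OF B gs]] by (simp add: Tg Tg0)
      also have "(\<Sum>l. (T ^^ n) (f l)) = suminf f - f 0"
        using suminf_split_head[OF fs] by (simp add: Tf)
      finally show ?thesis by (simp add: z_def algebra_simps)
    qed
    moreover have Sz: "(S ^^ n) z = z"
      using STn[of n z] Tz by simp
    have iter: "(R ^^ (k * n)) z = z" if "(R ^^ n) z = z" for k and R :: "'x \<Rightarrow> 'x"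
      by (induction k) (simp_all add: funpow_add that)
    ultimately show ?thesis using n Sz iter by blast
  qed
  show "chaotic (\<lambda>n. T ^^ n)"
  proof (rule chaoticI)
    fix x y :: 'x and e :: real assume e: "0 < e"
    then obtain n x' y' where n: "n \<ge> 1" and *: "norm (x' - x) < e / 2" "norm (y' - y) < e / 2"
      "norm ((T ^^ n) x') < e / 2" "norm ((S ^^ n) y') < e / 2"
      using trans[of "e / 2" x y] by auto
    have "norm ((T ^^ n) (x' + (S ^^ n) y') - y) = norm ((T ^^ n) x' + (y' - y))"
      by (simp add: linear_add[OF lin(1)] TSn add_diff_eq)
    then have "norm ((T ^^ n) (x' + (S ^^ n) y') - y) < e"
      using norm_triangle_ineq[of "(T ^^ n) x'" "y' - y"] * by linarith
    moreover have "norm (x' + (S ^^ n) y' - x) < e"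
      using norm_triangle_ineq[of "x' - x" "(S ^^ n) y'"] * by (simp add: algebra_simps)
    ultimately show "\<exists>n\<ge>1. \<exists>z. norm (z - x) < e \<and> norm ((T ^^ n) z - y) < e"
      using n by blast
  next
    fix x :: 'x and e :: real assume "0 < e"
    from periodic[OF this, of x] show "\<exists>z\<in>periodic_elements (\<lambda>n. T ^^ n). norm (z - x) < e"
      unfolding periodic_elements_def by blast
  qed
  show "chaotic (\<lambda>n x. (1 / 2) *\<^sub>R ((T ^^ n) x + (S ^^ n) x))"
  proof (rule chaoticI)
    fix x y :: 'x and e :: real assume e: "0 < e"
    then obtain n x' y' where n: "n \<ge> 1" and *: "norm (x' - x) < e / 3" "norm (y' - y) < e / 3"
      "norm ((T ^^ n) x') < e / 3" "norm ((S ^^ n) x') < e / 3" "norm ((S ^^ n) y') < e / 3"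
      "norm ((S ^^ (n + n)) y') < e / 3"
      using trans[of "e / 3" x y] by auto
    \<comment> \<open>The factor 2 compensates the 1/2 of the mean, since T^n recovers
      \<open>2 *\<^sub>R y'\<close>. It costs two thirds of e in the distance to x, hence the bounds
      by e/3.\<close>
    define z where "z = x' + 2 *\<^sub>R (S ^^ n) y'"
    have Tz: "(T ^^ n) z = (T ^^ n) x' + 2 *\<^sub>R y'"
      by (simp add: z_def linear_add[OF lin(1)] linear_scale[OF lin(1)] TSn)
    have Sz: "(S ^^ n) z = (S ^^ n) x' + 2 *\<^sub>R (S ^^ (n + n)) y'"
      by (simp add: z_def linear_add[OF lin(2)] linear_scale[OF lin(2)] funpow_add)
    have "(1 / 2) *\<^sub>R ((T ^^ n) z + (S ^^ n) z) - y =
        (1 / 2) *\<^sub>R ((T ^^ n) x' + (S ^^ n) x') + ((y' - y) + (S ^^ (n + n)) y')"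
      unfolding Tz Sz by (simp add: algebra_simps)
    also have "norm \<dots> \<le> norm ((1 / 2) *\<^sub>R ((T ^^ n) x' + (S ^^ n) x')) + norm ((y' - y) + (S ^^ (n + n)) y')"
      by (rule norm_triangle_ineq)
    also have "\<dots> < e"
      using norm_triangle_ineq[of "(T ^^ n) x'" "(S ^^ n) x'"] norm_triangle_ineq[of "y' - y" "(S ^^ (n + n)) y'"] *
      by simp
    finally have "norm ((1 / 2) *\<^sub>R ((T ^^ n) z + (S ^^ n) z) - y) < e" .
    moreover have "norm (z - x) < e"
      using norm_triangle_ineq[of "x' - x" "2 *\<^sub>R (S ^^ n) y'"] * by (simp add: z_def algebra_simps)
    ultimately show "\<exists>n\<ge>1. \<exists>z. norm (z - x) < e \<and> norm ((1 / 2) *\<^sub>R ((T ^^ n) z + (S ^^ n) z) - y) < e"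
      using n by blast
  next
    fix x :: 'x and e :: real assume "0 < e"
    from periodic[OF this, of x] obtain z n where zn: "n \<ge> 1" "norm (z - x) < e"
      "\<And>k. (T ^^ (k * n)) z = z" "\<And>k. (S ^^ (k * n)) z = z"
      by blast
    have "(1 / 2) *\<^sub>R ((T ^^ (k * n)) z + (S ^^ (k * n)) z) = z" for k
      by (simp add: zn(3,4) flip: scaleR_2)
    then show "\<exists>z\<in>periodic_elements (\<lambda>n x. (1 / 2) *\<^sub>R ((T ^^ n) x + (S ^^ n) x)). norm (z - x) < e"
      using zn unfolding periodic_elements_def by blast
  qed
qed

section \<open>Restrictions and their orbits\<close>

text \<open>The sets that enclose E for \<mu> also serve |\<mu>|, whose own variation is at most
  |\<mu>|. Turning |\<mu>| into a complex Radon measure allows two measures to be controlled by a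
  single one.\<close>

lemma radon_abs:
  fixes \<mu> :: "'a::t2_space radon_measure"
  shows "radon (\<lambda>E. complex_of_real (measure (variation_measure (apply_radon \<mu>)) E))" (is "radon ?m")
proof -
  let ?V = "variation_measure (apply_radon \<mu>)"
  interpret finite_measure ?V by (rule finite_measure_variation[OF vector_measure_apply])
  have vm: "vector_measure ?m"
    using vector_measure_sum_measures[of "{()}" "\<lambda>_. ?V" "\<lambda>_. 1"] finite_measure_axioms by simp
  have "variation ?m E \<le> emeasure ?V E" for E
    by (rule variation_le_emeasure) (simp_all add: emeasure_eq_measure)
  then have le: "variation ?m E \<le> variation (apply_radon \<mu>) E" for E
    by (simp add: emeasure_variation_measure[OF vector_measure_apply])
  show ?thesis
    unfolding radon_iff[OF vm]
    using radon_apply[of \<mu>, unfolded radon_iff[OF vector_measure_apply]] le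
    by (meson le_less_trans)
qed

lemma sup0_upper:
  assumes "bdd_above (f ` S)" "x \<in> S" shows "f x \<le> sup0 S f"
  using assms by (auto simp: sup0_def intro: cSUP_upper)

lemma sup0_nonneg:
  assumes "bdd_above (f ` S)" "\<And>x. x \<in> S \<Longrightarrow> 0 \<le> f x" shows "0 \<le> sup0 S f"
proof (cases "S = {}")
  case False
  then obtain x where "x \<in> S" by blast
  then show ?thesis using assms sup0_upper[OF assms(1)] by (meson order_trans)
qed (simp add: sup0_def)

lemma push_data_id: "push_data id (\<lambda>_. 1)"
  by (simp add: push_data_def homeomorphism_def continuous_on_id id_def inv_id[unfolded id_def])

lemma push_data_indicator:
  assumes "D \<in> sets borel" shows "push_data id (indicator D)"
proof -
  have "bounded (range (indicator D :: 'a \<Rightarrow> real))"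
    by (rule boundedI[of _ 1]) (auto simp: indicator_def)
  then show ?thesis
    using assms push_data_id unfolding push_data_def by auto
qed

text \<open>Induction with the new push outermost: by \<open>weighted_push_comp\<close> the density
  acquires the factor v at the n-th iterate, so the product runs along the orbit of x.\<close>

lemma weighted_push_funpow:
  assumes pd: "push_data \<beta> v"
  shows "push_data (\<beta> ^^ n) (\<lambda>x. \<Prod>j<n. v ((\<beta> ^^ j) x))"
    and "(weighted_push \<beta> v ^^ n) \<mu> = weighted_push (\<beta> ^^ n) (\<lambda>x. \<Prod>j<n. v ((\<beta> ^^ j) x)) \<mu>"
proof (induction n)
  case 0
  { case 1 show ?case using push_data_id by (simp add: id_def) }
  { case 2 show ?case using weighted_push_id[of \<mu>] by (simp add: id_def) }
next
  case (Suc n)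
  { case 1 show ?case using push_data_comp[OF pd Suc(1)] by (simp add: o_def) }
  { case 2 show ?case using weighted_push_comp[OF pd Suc(1)] Suc(2) by (simp add: o_def) }
qed

definition restrict_radon :: "'a::t2_space set \<Rightarrow> 'a radon_measure \<Rightarrow> 'a radon_measure" where
  "restrict_radon D = weighted_push id (indicator D)"

lemma apply_restrict_radon:
  assumes D: "D \<in> sets borel" and E: "E \<in> sets borel"
  shows "apply_radon (restrict_radon D \<mu>) E = apply_radon \<mu> (D \<inter> E)"
proof -
  have "(\<lambda>x. of_real (indicator D x) * indicator E (id x)) = (indicator (D \<inter> E) :: 'a \<Rightarrow> complex)"
    by (auto simp: indicator_def)
  then show ?thesis
    using D E unfolding restrict_radon_def apply_weighted_push_integral[OF push_data_indicator[OF D] E]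
    by (simp add: radon_integral_indicator)
qed

text \<open>The difference is, up to sign, the restriction to the complement of \<open>D\<close>;
  the factor 4 is inherited from the bound for weighted images.\<close>

lemma norm_restrict_radon_diff_le:
  assumes D: "D \<in> sets borel"
  shows "norm (restrict_radon D \<mu> - \<mu>) \<le> 4 * measure (variation_measure (apply_radon \<mu>)) (- D)"
proof -
  have D': "- D \<in> sets borel" using D by simp
  have "\<mu> - restrict_radon D \<mu> = restrict_radon (- D) \<mu>"
  proof (rule radon_measure_eqI)
    fix E :: "'a set" assume E: "E \<in> sets borel"
    have "apply_radon \<mu> ((D \<inter> E) \<union> (- D \<inter> E)) = apply_radon \<mu> (D \<inter> E) + apply_radon \<mu> (- D \<inter> E)"
      using D D' E by (intro vector_measure_Un[OF vector_measure_apply]) auto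
    moreover have "(D \<inter> E) \<union> (- D \<inter> E) = E" by blast
    ultimately show "apply_radon (\<mu> - restrict_radon D \<mu>) E = apply_radon (restrict_radon (- D) \<mu>) E"
      by (simp add: apply_radon_diff apply_restrict_radon D D' E del: Int_Un_distrib)
  qed
  then show ?thesis
    using norm_weighted_push_le[OF push_data_indicator[OF D'], of 1 "- D" \<mu>] D'
    by (simp add: restrict_radon_def norm_minus_commute)
qed

text \<open>Restricting and then pushing is a single push whose density vanishes off
  \<open>D\<close>, so v needs to be small on \<open>D\<close> only.\<close>

lemma norm_push_restrict_radon_le:
  assumes pd: "push_data \<beta> v" and D: "D \<in> sets borel" and C: "0 \<le> C" "\<And>x. x \<in> D \<Longrightarrow> v x \<le> C"
  shows "norm (weighted_push \<beta> v (restrict_radon D \<mu>)) \<le> 4 * C * norm \<mu>"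
proof -
  have "norm (weighted_push \<beta> v (restrict_radon D \<mu>)) \<le> 4 * C * measure (variation_measure (apply_radon \<mu>)) D"
    unfolding restrict_radon_def weighted_push_comp[OF pd push_data_indicator[OF D]]
    by (rule norm_weighted_push_le[OF push_data_comp[OF pd push_data_indicator[OF D]] C(1) _ D])
      (use C(2) in \<open>auto simp: indicator_def\<close>)
  also have "\<dots> \<le> 4 * C * norm \<mu>"
    using C(1) finite_measure.bounded_measure[OF finite_measure_variation[OF vector_measure_apply], of \<mu> D]
    by (intro mult_left_mono) (simp_all add: norm_radon_measure_def variation_eq_measure)
  finally show ?thesis .
qed

text \<open>Each orbit term is at most \<open>4 * M\<close> times the corresponding supremum, which
  explains the threshold \<open>e / (4 * M)\<close>. A bound M in place of the norm is positive and
  can be shared by two measures.\<close>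

lemma orbit_restrict_radon_small:
  assumes pd: "push_data \<beta> v" and D: "D \<in> sets borel"
    and sum: "summable (\<lambda>l. sup0 D (\<lambda>x. \<Prod>j<Suc l * n. v ((\<beta> ^^ j) x)))"
    and small: "(\<Sum>l. sup0 D (\<lambda>x. \<Prod>j<Suc l * n. v ((\<beta> ^^ j) x))) < e / (4 * M)"
    and M: "0 < M" "norm \<mu> \<le> M"
  shows "summable (\<lambda>l. norm ((weighted_push \<beta> v ^^ (Suc l * n)) (restrict_radon D \<mu>)))" (is ?summable)
    and "(\<Sum>l. norm ((weighted_push \<beta> v ^^ (Suc l * n)) (restrict_radon D \<mu>))) < e"
proof -
  define s where "s l = sup0 D (\<lambda>x. \<Prod>j<Suc l * n. v ((\<beta> ^^ j) x))" for l
  have le: "norm ((weighted_push \<beta> v ^^ (Suc l * n)) (restrict_radon D \<mu>)) \<le> 4 * M * s l" for l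
  proof -
    note pdn = weighted_push_funpow(1)[OF pd, of "Suc l * n"]
    \<comment> \<open>Boundedness makes the real supremum a true upper bound; for empty
      \<open>D\<close> the value of \<open>sup0\<close> is 0.\<close>
    have bdd: "bdd_above ((\<lambda>x. \<Prod>j<Suc l * n. v ((\<beta> ^^ j) x)) ` D)"
      using push_data_bound_ex[OF pdn] by (auto intro: bdd_aboveI2)
    have s: "0 \<le> s l" unfolding s_def by (rule sup0_nonneg[OF bdd push_data_nonneg[OF pdn]])
    have "norm ((weighted_push \<beta> v ^^ (Suc l * n)) (restrict_radon D \<mu>)) \<le> 4 * s l * norm \<mu>"
      unfolding weighted_push_funpow(2)[OF pd] s_def
      by (rule norm_push_restrict_radon_le[OF pdn D s[unfolded s_def] sup0_upper[OF bdd]])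
    also have "\<dots> \<le> 4 * s l * M" using s M by (intro mult_left_mono) auto
    finally show ?thesis by (simp add: mult_ac)
  qed
  have sum_s: "summable (\<lambda>l. 4 * M * s l)"
    using sum unfolding s_def by (rule summable_mult)
  show ?summable
    by (rule summable_comparison_test'[OF sum_s]) (simp only: real_norm_def abs_norm_cancel le)
  then have "(\<Sum>l. norm ((weighted_push \<beta> v ^^ (Suc l * n)) (restrict_radon D \<mu>))) \<le> (\<Sum>l. 4 * M * s l)"
    by (rule suminf_le[OF le _ sum_s])
  also have "\<dots> = 4 * M * (\<Sum>l. s l)"
    using sum unfolding s_def by (rule suminf_mult)
  also have "\<dots> < e"
    using small M unfolding s_def[symmetric] by (simp add: field_simps)
  finally show "(\<Sum>l. norm ((weighted_push \<beta> v ^^ (Suc l * n)) (restrict_radon D \<mu>))) < e" .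
qed

section \<open>From smallness on compact sets to chaos of the adjoints\<close>

theorem proposition3p5:
  fixes \<alpha> :: "'a::t2_space \<Rightarrow> 'a" and w :: "'a \<Rightarrow> real"
  assumes "locally_compact_space (euclidean :: 'a topology)"
    and "homeomorphism UNIV UNIV \<alpha> (inv \<alpha>)"
    and "aperiodic \<alpha>"
    and "\<And>x. 0 < w x"
    and "bounded (range w)"
    and "(\<lambda>x. 1 / w x) \<in> bcontfun"
    and "\<And>(K :: 'a set) (\<mu> :: 'a radon_measure).
      compact K \<Longrightarrow> variation (apply_radon \<mu>) (- K) = 0 \<Longrightarrow>
      \<exists>(A :: nat \<Rightarrow> 'a set) (n :: nat \<Rightarrow> nat).
        (\<forall>k. A k \<in> sets borel \<and> A k \<subseteq> K) \<and>
        strict_mono n \<and> (\<forall>k. 1 \<le> n k) \<and>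
        (\<lambda>k. variation (apply_radon \<mu>) (A k)) \<longlonglongrightarrow> 0 \<and>
        (\<forall>k. summable (\<lambda>l. sup0 (K \<inter> - A k)
                (\<lambda>t. \<Prod>j<Suc l * n k. w ((\<alpha> ^^ j) t)))) \<and>
        (\<forall>k. summable (\<lambda>l. sup0 (K \<inter> - A k)
                (\<lambda>t. \<Prod>j=1..Suc l * n k. inverse (w ((inv \<alpha> ^^ j) t))))) \<and>
        (\<lambda>k. \<Sum>l. sup0 (K \<inter> - A k)
                (\<lambda>t. \<Prod>j<Suc l * n k. w ((\<alpha> ^^ j) t))) \<longlonglongrightarrow> 0 \<and>
        (\<lambda>k. \<Sum>l. sup0 (K \<inter> - A k)
                (\<lambda>t. \<Prod>j=1..Suc l * n k. inverse (w ((inv \<alpha> ^^ j) t)))) \<longlonglongrightarrow> 0"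
  shows "chaotic (\<lambda>n. wcomp_adj \<alpha> w ^^ n) \<and> chaotic (cosine_adj \<alpha> w)"
proof -
  \<comment> \<open>The inverse operator composes with \<open>inv \<alpha>\<close> and divides by w
    at \<open>inv \<alpha> x\<close>, which gives its density.\<close>
  define w' where "w' x = 1 / w (inv \<alpha> x)" for x
  define T where "T = weighted_push \<alpha> w"
  define S where "S = weighted_push (inv \<alpha>) w'"
  have \<alpha>: "\<alpha> (inv \<alpha> x) = x" "inv \<alpha> (\<alpha> x) = x" for x
    using assms(2) by (auto simp: homeomorphism_def)
  have inv_inv: "inv (inv \<alpha>) = \<alpha>"
    using \<alpha> by (intro inv_inv_eq) (metis bijI')
  have cont: "continuous_on UNIV (\<lambda>x. 1 / w x)" and bdd: "bounded (range (\<lambda>x. 1 / w x))"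
    using assms(6) by (auto simp: bcontfun_def)
  \<comment> \<open>Continuity of w is recovered from that of its reciprocal.\<close>
  have "continuous_on UNIV (\<lambda>x. 1 / (1 / w x))"
    using assms(4) by (intro continuous_intros cont) (simp add: less_imp_neq[THEN not_sym])
  then have pd_w: "push_data \<alpha> w"
    using assms(2,4,5) by (simp add: push_data_def borel_measurable_continuous_onI less_imp_le)
  have "continuous_on UNIV (inv \<alpha>)"
    using assms(2) by (simp add: homeomorphism_def)
  then have "continuous_on UNIV ((\<lambda>x. 1 / w x) \<circ> inv \<alpha>)"
    by (rule continuous_on_compose) (rule continuous_on_subset[OF cont], simp)
  moreover have "bounded (range w')"
    by (rule bounded_subset[OF bdd]) (auto simp: w'_def)
  ultimately have pd_w': "push_data (inv \<alpha>) w'"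
    using assms(2,4) homeomorphism_symD[OF assms(2)]
    by (simp add: push_data_def inv_inv w'_def[abs_def] o_def borel_measurable_continuous_onI less_imp_le)
  have wcomp: "wcomp_adj \<alpha> w = T"
    unfolding wcomp_adj_def T_def
    by (rule radon_adjoint_eq_weighted_push[OF assms(1) pd_w]) (simp add: wcomp_def)
  have wcomp_inv: "wcomp_inv_adj \<alpha> w = S"
    unfolding wcomp_inv_adj_def S_def
    by (rule radon_adjoint_eq_weighted_push[OF assms(1) pd_w']) (simp add: wcomp_inv_def w'_def)
  have cosine: "cosine_adj \<alpha> w = (\<lambda>n x. (1 / 2) *\<^sub>R ((T ^^ n) x + (S ^^ n) x))"
    by (simp add: cosine_adj_def fun_eq_iff wcomp wcomp_inv)
  have w_nz: "w x \<noteq> 0" for x using assms(4)[of x] by simp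
  have id: "weighted_push \<beta> v \<mu> = \<mu>" if "\<And>x. \<beta> x = x" "\<And>x. v x = 1" for \<beta> v and \<mu> :: "'a radon_measure"
    using weighted_push_id[of \<mu>] that by (metis eq_id_iff ext)
  have TS: "T (S \<mu>) = \<mu>" and ST: "S (T \<mu>) = \<mu>" for \<mu>
    by (simp_all add: T_def S_def weighted_push_comp[OF pd_w pd_w'] weighted_push_comp[OF pd_w' pd_w]
      id \<alpha> w'_def w_nz)
  \<comment> \<open>Since w' contains one backward step, its j-th factor is the reciprocal of w at
    backward iterate j + 1. This turns the range j < n into the range 1..n of the
    hypothesis.\<close>
  have prod_w': "(\<Prod>j<n. w' ((inv \<alpha> ^^ j) t)) = (\<Prod>j=1..n. inverse (w ((inv \<alpha> ^^ j) t)))" for n t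
    by (simp add: prod.atLeast1_atMost_eq w'_def inverse_eq_divide)
  have small: "\<exists>n\<ge>1. \<exists>\<mu>' \<nu>'. norm (\<mu>' - \<mu>) < e \<and> norm (\<nu>' - \<nu>) < e \<and>
      (\<forall>\<rho>\<in>{\<mu>', \<nu>'}. \<forall>R\<in>{T, S}. summable (\<lambda>l. norm ((R ^^ (Suc l * n)) \<rho>)) \<and>
        (\<Sum>l. norm ((R ^^ (Suc l * n)) \<rho>)) < e)"
    if e: "0 < e" for \<mu> \<nu> :: "'a radon_measure" and e
  proof -
    let ?V = "\<lambda>\<rho> :: 'a radon_measure. measure (variation_measure (apply_radon \<rho>))"
    \<comment> \<open>The hypothesis handles one measure at a time; applied to |\<mu>| + |\<nu>| it
      yields the same sets and indices for both.\<close>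
    define total where "total = Radon (\<lambda>E. complex_of_real (?V \<mu> E)) + Radon (\<lambda>E. complex_of_real (?V \<nu> E))"
    have total: "apply_radon total E = of_real (?V \<mu> E + ?V \<nu> E)" for E
      by (simp add: total_def plus_radon_measure.rep_eq Radon_inverse radon_abs)
    have V_le: "?V \<rho> E \<le> norm (apply_radon total E)" if "\<rho> \<in> {\<mu>, \<nu>}" for \<rho> E
      using that unfolding total norm_of_real by auto
    have norm_le_V: "norm (apply_radon \<rho> E) \<le> ?V \<rho> E" if "E \<in> sets borel" for \<rho> E
      using norm_le_variation[OF that, of "apply_radon \<rho>"] by (simp add: variation_eq_measure)
    \<comment> \<open>The restriction error is at most 4 times the mass on - K plus the mass on
      \<open>A k\<close>; two eighths times 4 make e.\<close>
    have "0 < e / 8" using e by simp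
    then obtain K where K: "compact K" "variation (apply_radon total) (- K) < ennreal (e / 8)"
      using radon_apply[of total, unfolded radon_iff[OF vector_measure_apply], rule_format, of UNIV "e / 8"]
      by (metis Compl_eq_Diff_UNIV sets.top space_borel top.extremum_uniqueI)
    have K_borel: "K \<in> sets borel" "- K \<in> sets borel" using K(1) by (simp_all add: compact_imp_closed)
    \<comment> \<open>Restriction to K secures zero variation off K, as the hypothesis demands, and
      changes no value on subsets of K.\<close>
    define \<kappa> where "\<kappa> = restrict_radon K total"
    have "variation (apply_radon \<kappa>) (- K) \<le> ennreal (4 * 1) * variation (apply_radon total) (id -` (- K) \<inter> K)"
      unfolding \<kappa>_def restrict_radon_def
      by (rule variation_weighted_push_le[OF push_data_indicator]) (use K_borel in auto)
    then have "variation (apply_radon \<kappa>) (- K) = 0"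
      by (simp add: variation_empty[OF vector_measure_apply])
    from assms(7)[OF K(1) this] obtain A n where
      A: "\<And>k. A k \<in> sets borel" "\<And>k. A k \<subseteq> K" and n: "\<And>k. 1 \<le> n k"
      and lim: "(\<lambda>k. variation (apply_radon \<kappa>) (A k)) \<longlonglongrightarrow> 0"
      and sumT: "\<And>k. summable (\<lambda>l. sup0 (K \<inter> - A k) (\<lambda>t. \<Prod>j<Suc l * n k. w ((\<alpha> ^^ j) t)))"
      and sumS: "\<And>k. summable (\<lambda>l. sup0 (K \<inter> - A k) (\<lambda>t. \<Prod>j<Suc l * n k. w' ((inv \<alpha> ^^ j) t)))"
      and limT: "(\<lambda>k. \<Sum>l. sup0 (K \<inter> - A k) (\<lambda>t. \<Prod>j<Suc l * n k. w ((\<alpha> ^^ j) t))) \<longlonglongrightarrow> 0"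
      and limS: "(\<lambda>k. \<Sum>l. sup0 (K \<inter> - A k) (\<lambda>t. \<Prod>j<Suc l * n k. w' ((inv \<alpha> ^^ j) t))) \<longlonglongrightarrow> 0"
      unfolding prod_w' by blast
    \<comment> \<open>A common bound for both norms; the added 1 makes it positive, so that
      \<open>e / (4 * M)\<close> is meaningful.\<close>
    define M where "M = norm \<mu> + norm \<nu> + 1"
    have M: "0 < M" "norm \<mu> \<le> M" "norm \<nu> \<le> M" by (simp_all add: M_def add_nonneg_pos)
    have pos: "0 < ennreal (e / 8)" "0 < e / (4 * M)" using e M by simp_all
    have "\<forall>\<^sub>F k in sequentially. variation (apply_radon \<kappa>) (A k) < ennreal (e / 8) \<and>
        (\<Sum>l. sup0 (K \<inter> - A k) (\<lambda>t. \<Prod>j<Suc l * n k. w ((\<alpha> ^^ j) t))) < e / (4 * M) \<and>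
        (\<Sum>l. sup0 (K \<inter> - A k) (\<lambda>t. \<Prod>j<Suc l * n k. w' ((inv \<alpha> ^^ j) t))) < e / (4 * M)"
      by (intro eventually_conj order_tendstoD(2)[OF lim pos(1)] order_tendstoD(2)[OF limT pos(2)]
        order_tendstoD(2)[OF limS pos(2)])
    then obtain k where k: "variation (apply_radon \<kappa>) (A k) < ennreal (e / 8)"
        "(\<Sum>l. sup0 (K \<inter> - A k) (\<lambda>t. \<Prod>j<Suc l * n k. w ((\<alpha> ^^ j) t))) < e / (4 * M)"
        "(\<Sum>l. sup0 (K \<inter> - A k) (\<lambda>t. \<Prod>j<Suc l * n k. w' ((inv \<alpha> ^^ j) t))) < e / (4 * M)"
      unfolding eventually_sequentially by blast
    define D where "D = K \<inter> - A k"
    have D: "D \<in> sets borel" using K_borel A by (simp add: D_def)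
    have close: "norm (restrict_radon D \<rho> - \<rho>) < e" if \<rho>: "\<rho> \<in> {\<mu>, \<nu>}" for \<rho>
    proof -
      have "ennreal (?V total (- K)) < ennreal (e / 8)"
        using K(2) by (simp add: variation_eq_measure)
      \<comment> \<open>The value of \<open>total\<close> is |\<mu>| + |\<nu>|, so it dominates each
        variation and is itself bounded by the variation of \<open>total\<close>.\<close>
      then have 1: "?V \<rho> (- K) < e / 8"
        using V_le[OF \<rho>, of "- K"] norm_le_V[OF K_borel(2), of total] by (simp add: ennreal_less_iff)
      have "K \<inter> A k = A k" using A(2) by blast
      then have "apply_radon \<kappa> (A k) = apply_radon total (A k)"
        unfolding \<kappa>_def by (simp add: apply_restrict_radon K_borel A(1))
      moreover have "?V \<kappa> (A k) < e / 8"
        using k(1) by (simp add: variation_eq_measure ennreal_less_iff)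
      \<comment> \<open>The variation of \<open>\<kappa>\<close> bounds its value on
        \<open>A k\<close>, which equals that of \<open>total\<close> because \<open>A k\<close>
        lies in K.\<close>
      ultimately have 2: "?V \<rho> (A k) < e / 8"
        using V_le[OF \<rho>, of "A k"] norm_le_V[OF A(1), of \<kappa> k] by simp
      have "- D = - K \<union> A k" by (auto simp: D_def)
      then have "?V \<rho> (- D) \<le> ?V \<rho> (- K) + ?V \<rho> (A k)"
        using measure_Un_le[of "- K" "variation_measure (apply_radon \<rho>)" "A k"] K_borel A(1) by simp
      then show ?thesis
        using norm_restrict_radon_diff_le[OF D, of \<rho>] 1 2 by simp
    qed
    have orbits: "\<forall>R\<in>{T, S}. summable (\<lambda>l. norm ((R ^^ (Suc l * n k)) (restrict_radon D \<rho>))) \<and>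
        (\<Sum>l. norm ((R ^^ (Suc l * n k)) (restrict_radon D \<rho>))) < e" if "norm \<rho> \<le> M" for \<rho>
      using orbit_restrict_radon_small[OF pd_w D sumT[of k, folded D_def] k(2)[folded D_def] M(1) that]
        orbit_restrict_radon_small[OF pd_w' D sumS[of k, folded D_def] k(3)[folded D_def] M(1) that]
      unfolding T_def S_def by blast
    show ?thesis
      using n[of k] close orbits[OF M(2)] orbits[OF M(3)]
      by (intro exI[of _ "n k"] conjI exI[of _ "restrict_radon D \<mu>"] exI[of _ "restrict_radon D \<nu>"]) auto
  qed
  have "bounded_linear T" "bounded_linear S"
    unfolding T_def S_def by (rule bounded_linear_weighted_push[OF pd_w] bounded_linear_weighted_push[OF pd_w'])+
  from chaotic_powers_and_cosines[OF this TS ST summable_radon_measure small]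
  show ?thesis unfolding wcomp cosine by blast
qed

end
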